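(* Let $q\in\mathbb C\setminus\{0\}$ be not a root of unity. Consider the representations $R^{(\varepsilon_1,\varepsilon_2,\varepsilon_3)}_{jj'}$ of $U'_q(\mathrm{so}_4)$ given by the formulas in the context, where $\varepsilon_1,\varepsilon_2,\varepsilon_3\in\{1,-1\}$, $j,j'\ge 0$, one of $j,j'$ is an integer and the other belongs to $\frac12+\mathbb Z$. The representations $R^{(\varepsilon_1,\varepsilon_2,\varepsilon_3)}_{jj'}$ with $j\ge j'$ are irreducible and pairwise nonequivalent.
   Context: Fix a square root $q^{1/2}$ of $q$; for $m\in\frac12\mathbb Z$ put $q^m=(q^{1/2})^{2m}$, $[m]=\frac{q^m-q^{-m}}{q-q^{-1}}$, $[m]_+=\frac{q^m+q^{-m}}{q-q^{-1}}$; $\mathrm i=\sqrt{-1}$. The complex unital associative algebra $U'_q(\mathrm{so}_4)$ is generated by $I_{21},I_{32},I_{43}$ with defining relations $$I_{21}I_{32}^2-(q+q^{-1})I_{32}I_{21}I_{32}+I_{32}^2I_{21}=-I_{21},\quad I_{32}I_{21}^2-(q+q^{-1})I_{21}I_{32}I_{21}+I_{21}^2I_{32}=-I_{32},$$ $$I_{32}I_{43}^2-(q+q^{-1})I_{43}I_{32}I_{43}+I_{43}^2I_{32}=-I_{32},\quad I_{43}I_{32}^2-(q+q^{-1})I_{32}I_{43}I_{32}+I_{32}^2I_{43}=-I_{43},$$ $$I_{21}I_{43}=I_{43}I_{21}.$$ The representation $R=R^{(\varepsilon_1,\varepsilon_2,\varepsilon_3)}_{jj'}$ (called of the nonclassical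 type) acts on the complex vector space with basis $|k,l\rangle$, where - if $j\in\frac12+\mathbb Z$, $j'\in\mathbb Z$: $k=j,j-1,\dots,\frac12$ and $l=j',j'-1,\dots,-j'$; - if $j\in\mathbb Z$, $j'\in\frac12+\mathbb Z$: $k=j,j-1,\dots,-j$ and $l=j',j'-1,\dots,\frac12$. In both cases $$R(I_{21})|k,l\rangle=\varepsilon_1[k+l]_+|k,l\rangle,\qquad R(I_{43})|k,l\rangle=\varepsilon_2[k-l]_+|k,l\rangle.$$ For $k\ne\frac12$ (when $j$ is half-integral), respectively $l\neq\frac12$ (when $j'$ is half-integral), $$R(I_{32})|k,l\rangle=\frac{1}{[k+l][k-l](q-q^{-1})}\Big\{-\mathrm i[j'-l][j-l]\,|k,l+1\rangle+\mathrm i[j'+l][j+l]\,|k,l-1\rangle-\mathrm i[j'-k][j-k]\,|k+1,l\rangle+\mathrm i[j'+k][j+k]\,|k-1,l\rangle\Big\}.$$ If $j$ is half-integral, $$R(I_{32})|\tfrac12,l\rangle=\frac{-1}{[l+\frac12][l-\frac12](q-q^{-1})}\Big\{-\mathrm i[j-l][j'-l]\,|\tfrac12,l+1\rangle+\mathrm i[j+l][j'+l]\,|\tfrac12,l-1\rangle-\mathrm i[j'-\tfrac12][j-\tfrac12]\,|\tfrac32,l\rangle+\mathrm i\,\varepsilon_3(-1)^l[j'+\tfrac12][j+\tfrac12]\,|\tfrac12,-l\rangle\Big\}.$$ If $j'$ is half-integral, $$R(I_{32})|k,\tfrac12\rangle=\frac{1}{[k+\frac12][k-\frac12](q-q^{-1})}\Big\{-\mathrm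 i[j-\tfrac12][j'-\tfrac12]\,|k,\tfrac32\rangle+\mathrm i\,\varepsilon_3(-1)^k[j+\tfrac12][j'+\tfrac12]\,|-k,\tfrac12\rangle-\mathrm i[j'-k][j-k]\,|k+1,\tfrac12\rangle+\mathrm i[j'+k][j+k]\,|k-1,\tfrac12\rangle\Big\}.$$ Vectors with indices outside the stated ranges occur only with zero coefficient and are read as $0$.
   Formalization: The printed boundary terms with iε₃ violate the defining relations (e.g. j=1/2, j'=0); with ε₃ in place of iε₃ the formulas are proved to be representations, and irreducibility and pairwise nonequivalence are proved for both the printed and the corrected formulas. *)

theory Defs
  imports Complex_Main "HOL-Library.Function_Algebras"
begin

text \<open>
  The argument \<open>s\<close> is the fixed square root of \<open>q\<close>. Half-integers are rational numbers;
  \<open>qpow s m\<close> is used only when \<open>2 * m\<close> is an integer.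
\<close>

definition qpow :: "complex \<Rightarrow> rat \<Rightarrow> complex" where
  "qpow s m = s powi \<lfloor>2 * m\<rfloor>"

definition qnum :: "complex \<Rightarrow> rat \<Rightarrow> complex" where
  "qnum s m = (qpow s m - qpow s (- m)) / (qpow s 1 - qpow s (- 1))"

definition qnum_plus :: "complex \<Rightarrow> rat \<Rightarrow> complex" where
  "qnum_plus s m = (qpow s m + qpow s (- m)) / (qpow s 1 - qpow s (- 1))"

definition half_odd :: "rat set" where
  "half_odd = {x. x - 1/2 \<in> \<int>}"

definition scale :: "complex \<Rightarrow> ('b \<Rightarrow> complex) \<Rightarrow> 'b \<Rightarrow> complex" where
  "scale c v = (\<lambda>x. c * v x)"

text \<open>
  The data of a candidate representation on a complex vector space: the space and the images of
  the three generators. Operators are total functions, and only their action on the space matters.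
\<close>

record 'b gen_action =
  Sp  :: "('b \<Rightarrow> complex) set"
  A21 :: "('b \<Rightarrow> complex) \<Rightarrow> 'b \<Rightarrow> complex"
  A32 :: "('b \<Rightarrow> complex) \<Rightarrow> 'b \<Rightarrow> complex"
  A43 :: "('b \<Rightarrow> complex) \<Rightarrow> 'b \<Rightarrow> complex"

definition linear_on :: "('b \<Rightarrow> complex) set \<Rightarrow> (('b \<Rightarrow> complex) \<Rightarrow> 'c \<Rightarrow> complex) \<Rightarrow> bool" where
  "linear_on V T \<longleftrightarrow>
     (\<forall>u\<in>V. \<forall>v\<in>V. T (u + v) = T u + T v) \<and> (\<forall>c. \<forall>v\<in>V. T (scale c v) = scale c (T v))"

definition cubic_rel ::
  "complex \<Rightarrow> ('b \<Rightarrow> complex) set \<Rightarrow> (('b \<Rightarrow> complex) \<Rightarrow> 'b \<Rightarrow> complex)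
     \<Rightarrow> (('b \<Rightarrow> complex) \<Rightarrow> 'b \<Rightarrow> complex) \<Rightarrow> bool" where
  "cubic_rel q V X Y \<longleftrightarrow>
     (\<forall>v\<in>V. X (Y (Y v)) - scale (q + inverse q) (Y (X (Y v))) + Y (Y (X v)) = - X v)"

text \<open>
  A representation of the algebra given by generators and relations: linear operators on the
  space that satisfy the defining relations of \<open>U'\<^sub>q(so\<^sub>4)\<close>.
\<close>

definition is_representation :: "complex \<Rightarrow> 'b gen_action \<Rightarrow> bool" where
  "is_representation q R \<longleftrightarrow>
     module.subspace scale (Sp R) \<and>
     (\<forall>X\<in>{A21 R, A32 R, A43 R}. linear_on (Sp R) X \<and> X ` Sp R \<subseteq> Sp R) \<and>
     cubic_rel q (Sp R) (A21 R) (A32 R) \<and> cubic_rel q (Sp R) (A32 R) (A21 R) \<and>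
     cubic_rel q (Sp R) (A32 R) (A43 R) \<and> cubic_rel q (Sp R) (A43 R) (A32 R) \<and>
     (\<forall>v\<in>Sp R. A21 R (A43 R v) = A43 R (A21 R v))"

definition irreducible_action :: "'b gen_action \<Rightarrow> bool" where
  "irreducible_action R \<longleftrightarrow>
     Sp R \<noteq> {0} \<and>
     (\<forall>W. module.subspace scale W \<and> W \<subseteq> Sp R \<and> (\<forall>X\<in>{A21 R, A32 R, A43 R}. X ` W \<subseteq> W)
        \<longrightarrow> W = {0} \<or> W = Sp R)"

definition equivalent_actions :: "'b gen_action \<Rightarrow> 'c gen_action \<Rightarrow> bool" where
  "equivalent_actions R R' \<longleftrightarrow>
     (\<exists>T. linear_on (Sp R) T \<and> bij_betw T (Sp R) (Sp R') \<and>
        (\<forall>v\<in>Sp R. T (A21 R v) = A21 R' (T v) \<and> T (A32 R v) = A32 R' (T v) \<and>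
                  T (A43 R v) = A43 R' (T v)))"

text \<open>The numbers \<open>a, a - 1, a - 2, \<dots>\<close> down to \<open>b\<close>.\<close>

definition descend :: "rat \<Rightarrow> rat \<Rightarrow> rat set" where
  "descend a b = {x. b \<le> x \<and> (\<exists>n::nat. x = a - of_nat n)}"

definition idx :: "rat \<Rightarrow> rat \<Rightarrow> (rat \<times> rat) set" where
  "idx j j' =
     (if j \<in> half_odd then descend j (1/2) \<times> descend j' (- j')
      else descend j (- j) \<times> descend j' (1/2))"

text \<open>The basis vector \<open>|k,l\<rangle>\<close>, read as \<open>0\<close> for indices outside the range.\<close>

definition ket :: "rat \<Rightarrow> rat \<Rightarrow> rat \<Rightarrow> rat \<Rightarrow> rat \<times> rat \<Rightarrow> complex" where
  "ket j j' k l = (\<lambda>x. if x = (k, l) \<and> x \<in> idx j j' then 1 else 0)"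

definition extend_linearly ::
  "rat \<Rightarrow> rat \<Rightarrow> (rat \<Rightarrow> rat \<Rightarrow> rat \<times> rat \<Rightarrow> complex) \<Rightarrow> (rat \<times> rat \<Rightarrow> complex)
     \<Rightarrow> rat \<times> rat \<Rightarrow> complex" where
  "extend_linearly j j' F v = (\<Sum>(k, l)\<in>idx j j'. scale (v (k, l)) (F k l))"

text \<open>
  The value of \<open>R(I\<^sub>3\<^sub>2)\<close> on a basis vector. The argument \<open>\<kappa>\<close> is the constant in front of
  \<open>\<epsilon>\<^sub>3\<close> in the two boundary formulas. The source prints \<open>\<kappa> = \<i>\<close>, but with that constant the
  operators never satisfy the defining relations (see the last lemma of this theory for the
  smallest case); they do for \<open>\<kappa> = 1\<close>. Indeed the boundary formulas arise from the generic
  one by identifying \<open>|-k,-l\<rangle>\<close> with a multiple \<open>c(k,l)\<close> of \<open>|k,l\<rangle>\<close>; compatibility with the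
  action forces \<open>c\<close> to change sign whenever \<open>k\<close> or \<open>l\<close> changes by one, and
  \<open>c(k,l) * c(-k,-l) = 1\<close> then forces \<open>c(k,l) = \<plusminus>\<i>\<close>, whose product with the generic \<open>\<i>\<close> is real.
\<close>

definition I32_ket ::
  "complex \<Rightarrow> complex \<Rightarrow> complex \<Rightarrow> rat \<Rightarrow> rat \<Rightarrow> rat \<Rightarrow> rat \<Rightarrow> rat \<times> rat \<Rightarrow> complex" where
  "I32_ket \<kappa> s e3 j j' k l =
    (if j \<in> half_odd \<and> k = 1/2 then
       scale (- 1 / (qnum s (l + 1/2) * qnum s (l - 1/2) * (qpow s 1 - qpow s (- 1))))
        (scale (- \<i> * qnum s (j - l) * qnum s (j' - l)) (ket j j' (1/2) (l + 1))
         + scale (\<i> * qnum s (j + l) * qnum s (j' + l)) (ket j j' (1/2) (l - 1))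
         + scale (- \<i> * qnum s (j' - 1/2) * qnum s (j - 1/2)) (ket j j' (3/2) l)
         + scale (\<kappa> * e3 * (- 1) powi \<lfloor>l\<rfloor> * qnum s (j' + 1/2) * qnum s (j + 1/2))
             (ket j j' (1/2) (- l)))
     else if j' \<in> half_odd \<and> l = 1/2 then
       scale (1 / (qnum s (k + 1/2) * qnum s (k - 1/2) * (qpow s 1 - qpow s (- 1))))
        (scale (- \<i> * qnum s (j - 1/2) * qnum s (j' - 1/2)) (ket j j' k (3/2))
         + scale (\<kappa> * e3 * (- 1) powi \<lfloor>k\<rfloor> * qnum s (j + 1/2) * qnum s (j' + 1/2))
             (ket j j' (- k) (1/2))
         + scale (- \<i> * qnum s (j' - k) * qnum s (j - k)) (ket j j' (k + 1) (1/2))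
         + scale (\<i> * qnum s (j' + k) * qnum s (j + k)) (ket j j' (k - 1) (1/2)))
     else
       scale (1 / (qnum s (k + l) * qnum s (k - l) * (qpow s 1 - qpow s (- 1))))
        (scale (- \<i> * qnum s (j' - l) * qnum s (j - l)) (ket j j' k (l + 1))
         + scale (\<i> * qnum s (j' + l) * qnum s (j + l)) (ket j j' k (l - 1))
         + scale (- \<i> * qnum s (j' - k) * qnum s (j - k)) (ket j j' (k + 1) l)
         + scale (\<i> * qnum s (j' + k) * qnum s (j + k)) (ket j j' (k - 1) l)))"

type_synonym params = "complex \<times> complex \<times> complex \<times> rat \<times> rat"

fun nonclassical :: "complex \<Rightarrow> complex \<Rightarrow> params \<Rightarrow> (rat \<times> rat) gen_action" where
  "nonclassical \<kappa> s (e1, e2, e3, j, j') =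
     \<lparr> Sp = module.span scale {ket j j' k l | k l. (k, l) \<in> idx j j'},
       A21 = extend_linearly j j' (\<lambda>k l. scale (e1 * qnum_plus s (k + l)) (ket j j' k l)),
       A32 = extend_linearly j j' (I32_ket \<kappa> s e3 j j'),
       A43 = extend_linearly j j' (\<lambda>k l. scale (e2 * qnum_plus s (k - l)) (ket j j' k l)) \<rparr>"

definition nonclassical_params :: "params set" where
  "nonclassical_params =
     {(e1, e2, e3, j, j'). e1 \<in> {1, - 1} \<and> e2 \<in> {1, - 1} \<and> e3 \<in> {1, - 1} \<and> 0 \<le> j \<and> 0 \<le> j' \<and>
        (j \<in> half_odd \<and> j' \<in> \<int> \<or> j \<in> \<int> \<and> j' \<in> half_odd)}"

definition ordered_params :: "params set" where
  "ordered_params = {(e1, e2, e3, j, j'). (e1, e2, e3, j, j') \<in> nonclassical_params \<and> j \<ge> j'}"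

lemma half_in_half_odd: "1/2 \<in> half_odd"
  by (simp add: half_odd_def)

lemma descend_0: "descend 0 0 = {0}"
  by (auto simp: descend_def)

lemma descend_half: "descend (1/2) (1/2) = {1/2}"
proof -
  have "n = 0" if "1/2 \<le> 1/2 - (of_nat n :: rat)" for n
    using that by simp
  then show ?thesis by (auto simp: descend_def)
qed

lemma idx_half_0: "idx (1/2) 0 = {(1/2, 0)}"
  by (simp add: idx_def half_in_half_odd descend_half descend_0)

lemma module_scale: "module (scale :: complex \<Rightarrow> ('b \<Rightarrow> complex) \<Rightarrow> 'b \<Rightarrow> complex)"
  by unfold_locales (auto simp: scale_def fun_eq_iff algebra_simps)

lemma printed_constant_not_representation:
  assumes "s \<noteq> 0" "\<And>n. n > 0 \<Longrightarrow> (s\<^sup>2) ^ n \<noteq> 1"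
    and "e1 \<in> {1, - 1}" "e2 \<in> {1, - 1}" "e3 \<in> {1, - 1}"
  shows "\<not> is_representation (s\<^sup>2) (nonclassical \<i> s (e1, e2, e3, 1/2, 0))"
proof
  assume rep: "is_representation (s\<^sup>2) (nonclassical \<i> s (e1, e2, e3, 1/2, 0))"
  define x where "x = ket (1/2) 0 (1/2) 0"
  let ?R = "nonclassical \<i> s (e1, e2, e3, 1/2, 0)"
  define D where "D = s - inverse s"
  have s2: "s\<^sup>2 \<noteq> 1" using assms(2)[of 1] by simp
  have s4: "s ^ 4 \<noteq> 1" using assms(2)[of 2] by (simp flip: power_mult)
  have D: "D \<noteq> 0" using s2 assms(1) by (auto simp: D_def field_simps power2_eq_square)
  have s2': "s\<^sup>2 + 1 \<noteq> 0"
  proof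
    assume "s\<^sup>2 + 1 = 0"
    then have "s\<^sup>2 = - 1" by (simp add: eq_neg_iff_add_eq_0)
    then have "(s\<^sup>2)\<^sup>2 = 1" by simp
    then show False using s4 by (simp flip: power_mult)
  qed
  have S: "s + inverse s \<noteq> 0" using s2' assms(1) by (auto simp: field_simps power2_eq_square)
  have E: "qpow s 1 - qpow s (- 1) = D * (s + inverse s)"
    using assms(1) by (simp add: qpow_def D_def field_simps power_int_def power2_eq_square)
  have fl: "\<lfloor>- 1 :: rat\<rfloor> = - 1" by (metis floor_of_int of_int_1 of_int_minus)
  have P: "qpow s (1/2) = s" "qpow s (- (1/2)) = inverse s"
    by (simp_all add: qpow_def fl power_int_minus)
  have D': "inverse s - s = - D" by (simp add: D_def)
  have E0: "D * (s + inverse s) \<noteq> 0" using D S by simp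
  have h: "qnum s (1/2) = 1 / (s + inverse s)" "qnum s (- (1/2)) = - 1 / (s + inverse s)"
    "qnum_plus s (1/2) = 1 / D" "qnum s 1 = 1"
    using D S E0 unfolding qnum_def qnum_plus_def E
    by (simp_all add: P D_def[symmetric] D' add.commute)
  have ket0: "ket (1/2) 0 k l = 0" if "(k, l) \<noteq> (1/2, 0)" for k l
    using that by (auto simp: ket_def idx_half_0 fun_eq_iff)
  have x1: "x (1/2, 0) = 1" by (simp add: x_def ket_def idx_half_0)
  have 1: "A21 ?R v = scale (v (1/2, 0) * e1 / D) x" for v
    using h by (simp add: extend_linearly_def idx_half_0 x_def scale_def mult_ac)
  have 2: "A32 ?R v = scale (v (1/2, 0) * (\<i> * e3 / D)) x" for v
  proof -
    define t where "t = s + inverse s"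
    have t: "t \<noteq> 0" using S by (simp add: t_def)
    have "A32 ?R v = scale (v (1/2, 0)) (scale (- 1 / (1 / t * (- 1 / t) * (D * t)))
        (scale (\<i> * e3 * (1 / t)) x))"
      using h by (simp add: extend_linearly_def idx_half_0 I32_ket_def half_in_half_odd ket0 E
          flip: x_def t_def) (simp add: scale_def fun_eq_iff)
    also have "\<dots> = scale (v (1/2, 0) * (\<i> * e3 / D)) x"
      using t D by (simp add: scale_def fun_eq_iff)
    finally show ?thesis .
  qed
  have "x \<in> Sp ?R"
    by (auto simp: x_def idx_half_0 intro!: module.span_base[OF module_scale])
  then have "A21 ?R (A32 ?R (A32 ?R x)) - scale (s\<^sup>2 + inverse (s\<^sup>2)) (A32 ?R (A21 ?R (A32 ?R x)))
      + A32 ?R (A32 ?R (A21 ?R x)) = - A21 ?R x"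
    using rep unfolding is_representation_def cubic_rel_def by blast
  then have "(A21 ?R (A32 ?R (A32 ?R x)) - scale (s\<^sup>2 + inverse (s\<^sup>2)) (A32 ?R (A21 ?R (A32 ?R x)))
      + A32 ?R (A32 ?R (A21 ?R x))) (1/2, 0) = (- A21 ?R x) (1/2, 0)"
    by (rule arg_cong)
  then have "(e1 / D) * (\<i> * e3 / D)\<^sup>2 * (2 - (s\<^sup>2 + inverse (s\<^sup>2))) = - (e1 / D)"
    unfolding 1 2 by (simp add: scale_def x1 algebra_simps power2_eq_square)
  moreover have "2 - (s\<^sup>2 + inverse (s\<^sup>2)) = - D\<^sup>2"
    using assms(1) by (simp add: D_def field_simps power2_eq_square)
  ultimately have "e1 / D = - (e1 / D)"
    using D assms(5) by (auto simp: power2_eq_square)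
  then show False using D assms(3) by auto
qed

end

theory Submission
  imports Defs
begin

text \<open>
  The boundary formulas come from the generic formula for \<open>I\<^sub>3\<^sub>2\<close> on the full rectangle
  \<open>|k| \<le> j, |l| \<le> j'\<close> by identifying \<open>|-k,-l\<rangle>\<close> with a multiple of \<open>|k,l\<rangle>\<close>, so the defining
  relations only have to be checked for the generic formula. There \<open>I\<^sub>3\<^sub>2\<close> moves \<open>k\<close> or \<open>l\<close> by one:
  the relation linear in \<open>I\<^sub>3\<^sub>2\<close> is an identity between the eigenvalues of \<open>I\<^sub>2\<^sub>1\<close> at neighbouring
  points, and in the quadratic one only the closed two-step paths survive, which gives a single
  identity for q-numbers.

  Since \<open>q\<close> is not a root of unity, \<open>I\<^sub>2\<^sub>1\<close> and \<open>I\<^sub>4\<^sub>3\<close> have simple joint spectrum. An invariant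
  subspace therefore contains a basis vector, and the nonzero entries of \<open>I\<^sub>3\<^sub>2\<close> lead from it to all
  the others. The joint spectrum determines \<open>\<epsilon>\<^sub>1, \<epsilon>\<^sub>2\<close> and the unordered pair \<open>{j, j'}\<close>; the diagonal
  entry of \<open>I\<^sub>3\<^sub>2\<close> at \<open>|1/2,0\<rangle>\<close> or \<open>|0,1/2\<rangle>\<close> then determines \<open>\<epsilon>\<^sub>3\<close>.
\<close>

subsection \<open>Half-integers and q-numbers\<close>

text \<open>\<open>qpow\<close> takes a floor, so its exponent laws hold only where the doubled
  argument is an integer; this set carries them.\<close>

definition half_ints :: "rat set" where
  "half_ints = {x. 2 * x \<in> \<int>}"

lemma half_ints_add [simp, intro]: "a \<in> half_ints \<Longrightarrow> b \<in> half_ints \<Longrightarrow> a + b \<in> half_ints"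
  by (simp add: half_ints_def distrib_left)

lemma half_ints_minus [simp]: "- a \<in> half_ints \<longleftrightarrow> a \<in> half_ints"
  by (simp add: half_ints_def)

lemma half_ints_diff [simp, intro]: "a \<in> half_ints \<Longrightarrow> b \<in> half_ints \<Longrightarrow> a - b \<in> half_ints"
  by (simp add: half_ints_def right_diff_distrib)

lemma half_ints_Ints: "a \<in> \<int> \<Longrightarrow> a \<in> half_ints"
  by (simp add: half_ints_def)

lemma half_ints_1 [simp]: "1 \<in> half_ints"
  by (simp add: half_ints_Ints)

lemma half_odd_not_Ints: "a \<in> half_odd \<Longrightarrow> a \<notin> \<int>"
proof
  assume "a \<in> half_odd" "a \<in> \<int>"
  then have "a - (a - 1/2) \<in> \<int>" unfolding half_odd_def by (intro Ints_diff) auto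
  then obtain n where "1/2 = (of_int n :: rat)" by (auto elim: Ints_cases)
  then have "(of_int (2 * n) :: rat) = of_int 1" by simp
  then have "2 * n = 1" by (simp only: of_int_eq_iff)
  then show False by presburger
qed

lemma half_odd_half_ints: "a \<in> half_odd \<Longrightarrow> a \<in> half_ints"
proof -
  assume "a \<in> half_odd"
  then have "2 * (a - 1/2) + 1 \<in> \<int>" unfolding half_odd_def by (intro Ints_add Ints_mult) auto
  then show ?thesis by (simp add: half_ints_def algebra_simps)
qed

text \<open>The condition is put on s rather than on q = s^2 because the values of
  \<open>qpow\<close> are powers of s; s^n = 1 would force q^n = 1.\<close>

locale generic_root =
  fixes s :: complex
  assumes s_nonzero: "s \<noteq> 0"
    and s_not_root: "\<And>n. n > 0 \<Longrightarrow> s ^ n \<noteq> 1"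
begin

abbreviation qdiff :: complex where
  "qdiff \<equiv> qpow s 1 - qpow s (- 1)"

lemma powi_eq_1:
  assumes "s powi n = 1"
  shows "n = 0"
proof (rule ccontr)
  assume "n \<noteq> 0"
  have "s ^ nat \<bar>n\<bar> = 1"
    using assms by (auto simp: power_int_def abs_if power_inverse split: if_splits)
  then show False using s_not_root[of "nat \<bar>n\<bar>"] \<open>n \<noteq> 0\<close> by simp
qed

lemma qpow_add: "a \<in> half_ints \<Longrightarrow> b \<in> half_ints \<Longrightarrow> qpow s (a + b) = qpow s a * qpow s b"
  by (auto simp: half_ints_def qpow_def distrib_left s_nonzero power_int_add elim!: Ints_cases
      simp flip: of_int_add)

lemma qpow_0 [simp]: "qpow s 0 = 1"
  by (simp add: qpow_def)

lemma qpow_nonzero [simp]: "qpow s a \<noteq> 0"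
  by (simp add: qpow_def s_nonzero)

lemma qpow_minus: "a \<in> half_ints \<Longrightarrow> qpow s (- a) = inverse (qpow s a)"
  using qpow_add[of a "- a"] by (simp add: field_simps)

lemma qpow_diff: "a \<in> half_ints \<Longrightarrow> b \<in> half_ints \<Longrightarrow> qpow s (a - b) = qpow s a / qpow s b"
  using qpow_add[of a "- b"] by (simp add: qpow_minus divide_inverse)

lemma qpow_eq_1: "a \<in> half_ints \<Longrightarrow> qpow s a = 1 \<Longrightarrow> a = 0"
  using powi_eq_1[of "\<lfloor>2 * a\<rfloor>"] by (auto simp: qpow_def half_ints_def elim!: Ints_cases)

lemma qpow_neq_minus_1: "a \<in> half_ints \<Longrightarrow> qpow s a \<noteq> - 1"
proof
  assume a: "a \<in> half_ints" "qpow s a = - 1"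
  then have "qpow s (a + a) = 1" by (simp only: qpow_add) simp
  moreover have "a + a \<in> half_ints" using a by blast
  ultimately have "a + a = 0" by (blast intro: qpow_eq_1)
  then show False using a by simp
qed

lemma qpow_inj: "a \<in> half_ints \<Longrightarrow> b \<in> half_ints \<Longrightarrow> qpow s a = qpow s b \<Longrightarrow> a = b"
  using qpow_eq_1[of "a - b"] by (simp add: qpow_diff)

lemma qpow_neq_minus: "a \<in> half_ints \<Longrightarrow> b \<in> half_ints \<Longrightarrow> qpow s a \<noteq> - qpow s b"
  using qpow_neq_minus_1[of "a - b"] by (auto simp: qpow_diff field_simps)

lemma qpow_1_neq [simp]: "qpow s 1 \<noteq> qpow s (- 1)"
proof
  assume "qpow s 1 = qpow s (- 1)"
  then have "(1 :: rat) = - 1" by (intro qpow_inj) auto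
  then show False by simp
qed

section \<open>Parity and product formulas for q-numbers\<close>

lemma qnum_minus: "qnum s (- a) = - qnum s a"
  unfolding qnum_def by (simp add: minus_divide_left)

lemma qnum_plus_minus: "qnum_plus s (- a) = qnum_plus s a"
  by (simp add: qnum_plus_def add.commute)

lemma qnum_0 [simp]: "qnum s 0 = 0"
  by (simp add: qnum_def)

lemma qnum_1 [simp]: "qnum s 1 = 1"
  by (simp add: qnum_def)

lemma qnum_nonzero:
  assumes "a \<in> half_ints" "a \<noteq> 0"
  shows "qnum s a \<noteq> 0"
proof -
  have "qpow s a \<noteq> qpow s (- a)"
  proof
    assume "qpow s a = qpow s (- a)"
    then have "a = - a" using assms(1) by (intro qpow_inj) simp_all
    then show False using assms(2) by simp
  qed
  then show ?thesis by (simp add: qnum_def)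
qed

text \<open>This and the next two lemmas are product-to-sum formulas, with \<open>qnum\<close> as
  hyperbolic sine and \<open>qnum_plus\<close> as hyperbolic cosine. The factor \<open>qdiff\<close>
  remains because each q-number brings its own denominator.\<close>

lemma qnum_mult:
  assumes "a \<in> half_ints" "b \<in> half_ints"
  shows "qdiff * (qnum s a * qnum s b) = qnum_plus s (a + b) - qnum_plus s (a - b)"
proof -
  \<comment> \<open>Naming the denominator keeps it a single nonzero atom while the numerators are
    expanded.\<close>
  define h where "h = qdiff"
  have "h \<noteq> 0" by (simp add: h_def)
  then show ?thesis
    unfolding qnum_def qnum_plus_def h_def[symmetric]
    by (simp only: assms qpow_add qpow_diff qpow_minus half_ints_add half_ints_diff)
       (simp add: field_simps)
qed

lemma qnum_plus_mult_qnum: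
  assumes "a \<in> half_ints" "b \<in> half_ints"
  shows "qdiff * (qnum_plus s a * qnum s b) = qnum s (a + b) - qnum s (a - b)"
proof -
  define h where "h = qdiff"
  have "h \<noteq> 0" by (simp add: h_def)
  then show ?thesis
    unfolding qnum_def qnum_plus_def h_def[symmetric]
    by (simp only: assms qpow_add qpow_diff qpow_minus half_ints_add half_ints_diff)
       (simp add: field_simps)
qed

lemma qnum_plus_mult:
  assumes "a \<in> half_ints" "b \<in> half_ints"
  shows "qdiff * (qnum_plus s a * qnum_plus s b) = qnum_plus s (a + b) + qnum_plus s (a - b)"
proof -
  define h where "h = qdiff"
  have "h \<noteq> 0" by (simp add: h_def)
  then show ?thesis
    unfolding qnum_def qnum_plus_def h_def[symmetric]
    by (simp only: assms qpow_add qpow_diff qpow_minus half_ints_add half_ints_diff)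
       (simp add: field_simps)
qed

text \<open>With x = \<open>qpow s a\<close>, y = \<open>qpow s b\<close> and d = e e', the equation
  x + 1/x = d (y + 1/y) has only the solutions x = d y and x = d/y. The sign d = -1 would put -1
  among the values of \<open>qpow\<close>.\<close>

lemma qnum_plus_eq:
  assumes ab: "a \<in> half_ints" "b \<in> half_ints" and e: "e \<in> {1, - 1}" "e' \<in> {1, - 1}"
    and eq: "e * qnum_plus s a = e' * qnum_plus s b"
  shows "e = e' \<and> (a = b \<or> a = - b)"
proof -
  have pm: "qpow s a * qpow s (- a) = 1" "qpow s b * qpow s (- b) = 1"
    using ab by (simp_all add: qpow_minus)
  have eq': "e * (qpow s a + qpow s (- a)) = e' * (qpow s b + qpow s (- b))"
    using eq by (simp add: qnum_plus_def)
  define d where "d = e * e'"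
  have d: "d = 1 \<or> d = - 1" "e * d = e'" "d * d = 1" using e by (auto simp: d_def)
  have "e * (qpow s a + qpow s (- a)) = e * (d * (qpow s b + qpow s (- b)))"
    using eq' d by (simp add: mult.assoc[symmetric])
  then have eq2: "qpow s a + qpow s (- a) = d * (qpow s b + qpow s (- b))"
    using e by auto
  have "(qpow s a - d * qpow s b) * (qpow s a - d * qpow s (- b))
      = qpow s a * qpow s a - qpow s a * (d * (qpow s b + qpow s (- b))) + (d * d) * (qpow s b * qpow s (- b))"
    by (simp add: algebra_simps)
  also have "\<dots> = 0" unfolding eq2[symmetric] by (simp add: algebra_simps d pm)
  finally have "qpow s a = d * qpow s b \<or> qpow s a = d * qpow s (- b)" by simp
  then obtain c where c: "c = b \<or> c = - b" "qpow s a = d * qpow s c" by blast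
  have c': "c \<in> half_ints" using c(1) ab by auto
  have "d = 1" using d(1) c(2) qpow_neq_minus[OF ab(1) c'] by auto
  then have "a = c" using c(2) qpow_inj[OF ab(1) c'] by simp
  then show ?thesis using c(1) d(2) \<open>d = 1\<close> by simp
qed

end

subsection \<open>The hopping formula on the full lattice\<close>

text \<open>Hopping amplitude, the same function for both coordinates: a step from x to x + 1
  carries \<open>amp\<close> at x, a step down carries it at -x. It vanishes at j and j', which
  closes off the rectangle.\<close>

definition amp :: "complex \<Rightarrow> rat \<Rightarrow> rat \<Rightarrow> rat \<Rightarrow> complex" where
  "amp s j j' x = qnum s (j' - x) * qnum s (j - x)"

definition wt :: "complex \<Rightarrow> rat \<Rightarrow> rat \<Rightarrow> complex" where
  "wt s k l = 1 / (qnum s (k + l) * qnum s (k - l) * (qpow s 1 - qpow s (- 1)))"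

section \<open>Identities for amplitudes and eigenvalues\<close>

context generic_root
begin

text \<open>The left side is the product of the amplitudes of a step from x to x + 1 and of the step
  back. The product formula, applied to the factors with j and to those with j', makes it quadratic
  in \<open>qnum_plus s (2 * x + 1)\<close>.\<close>

lemma amp_mult_amp:
  assumes "j \<in> half_ints" "j' \<in> half_ints" "x \<in> half_ints"
  shows "qdiff\<^sup>2 * (amp s j j' x * amp s j j' (- x - 1)) =
    (qnum_plus s (2 * j + 1) - qnum_plus s (2 * x + 1)) *
    (qnum_plus s (2 * j' + 1) - qnum_plus s (2 * x + 1))"
proof -
  have *: "qdiff * (qnum s (a - x) * qnum s (a - (- x - 1)))
      = qnum_plus s (2 * a + 1) - qnum_plus s (2 * x + 1)" if "a \<in> half_ints" for a
  proof -
    have "qdiff * (qnum s (a - x) * qnum s (a - (- x - 1)))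
       = qnum_plus s ((a - x) + (a - (- x - 1))) - qnum_plus s ((a - x) - (a - (- x - 1)))"
      by (intro qnum_mult) (use that assms in auto)
    also have "(a - x) + (a - (- x - 1)) = 2 * a + 1" by simp
    also have "(a - x) - (a - (- x - 1)) = - (2 * x + 1)" by simp
    finally show ?thesis by (simp only: qnum_plus_minus)
  qed
  show ?thesis
    unfolding amp_def *[OF assms(1), symmetric] *[OF assms(2), symmetric]
    by (simp only: power2_eq_square ac_simps)
qed

lemma qnum_plus_diff:
  assumes "a \<in> half_ints" "b \<in> half_ints" "c = a + b" "d = a - b"
  shows "qnum_plus s c - qnum_plus s d = qdiff * (qnum s a * qnum s b)"
  using qnum_mult[OF assms(1,2)] assms(3,4) by simp

text \<open>F is the quadratic polynomial with roots T j and T j', up to a factor, evaluated at T x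
  = \<open>qnum_plus s (2 * x + 1)\<close>. Hence a difference of values of F has a factor T x - T
  y, which cancels the denominators.\<close>

lemma amp_diagonal_identity:
  assumes H: "j \<in> half_ints" "j' \<in> half_ints" "k \<in> half_ints" "l \<in> half_ints"
    and nz: "k - l + 1 \<noteq> 0" "k - l - 1 \<noteq> 0"
  defines "F \<equiv> \<lambda>x. amp s j j' x * amp s j j' (- x - 1)"
  shows "(F (l - 1) - F k) / qnum s (k - l + 1) + (F (k - 1) - F l) / qnum s (k - l - 1)
    = - (qnum_plus s (k + l) * qnum s (k + l) * qnum s (k - l) * qdiff)"
proof -
  define h where "h = qdiff"
  have h0: "h \<noteq> 0" by (simp add: h_def)
  define T where "T = (\<lambda>x. qnum_plus s (2 * x + 1))"
  have F: "F x = (T j - T x) * (T j' - T x) / h\<^sup>2" if "x \<in> half_ints" for x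
    unfolding F_def T_def amp_mult_amp[OF H(1,2) that, symmetric] h_def[symmetric] using h0 by simp
  have Fd: "F x - F y = (T x - T y) * (T x + T y - T j - T j') / h\<^sup>2"
    if "x \<in> half_ints" "y \<in> half_ints" for x y
    unfolding F[OF that(1)] F[OF that(2)] diff_divide_distrib[symmetric] by (simp add: algebra_simps)
  have n0: "qnum s (k - l + 1) \<noteq> 0" "qnum s (k - l - 1) \<noteq> 0"
    by (rule qnum_nonzero; use H nz in \<open>simp add: algebra_simps\<close>)+
  have t1: "T (l - 1) - T k = - h * (qnum s (k + l) * qnum s (k - l + 1))"
  proof -
    have "T (l - 1) - T k = h * (qnum s (k + l) * qnum s (- (k - l + 1)))"
      unfolding T_def h_def by (rule qnum_plus_diff) (use H in auto)
    then show ?thesis by (simp only: qnum_minus mult_minus_left mult_minus_right)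
  qed
  have t2: "T (k - 1) - T l = h * (qnum s (k + l) * qnum s (k - l - 1))"
    unfolding T_def h_def by (rule qnum_plus_diff) (use H in auto)
  have t3: "T x - T (x - 1) = h * qnum s (2 * x)" if "x \<in> half_ints" for x
  proof -
    have "x + x \<in> half_ints" using that by blast
    then have "T x - T (x - 1) = h * (qnum s (2 * x) * qnum s 1)"
      unfolding T_def h_def by (intro qnum_plus_diff) auto
    then show ?thesis by simp
  qed
  have t4: "h * (qnum_plus s (k + l) * qnum s (k - l)) = qnum s (2 * k) - qnum s (2 * l)"
  proof -
    have "(k + l) + (k - l) = 2 * k" "(k + l) - (k - l) = 2 * l" by auto
    then show ?thesis
      using qnum_plus_mult_qnum[of "k + l" "k - l"] H unfolding h_def by auto
  qed
  have F1: "(F (l - 1) - F k) / qnum s (k - l + 1) = - qnum s (k + l) * (T (l - 1) + T k - T j - T j') / h"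
    using H h0 n0 by (simp add: Fd t1 power2_eq_square)
  have F2: "(F (k - 1) - F l) / qnum s (k - l - 1) = qnum s (k + l) * (T (k - 1) + T l - T j - T j') / h"
    using H h0 n0 by (simp add: Fd t2 power2_eq_square)
  \<comment> \<open>Here u and v stand for T j and T j'; they drop out, so the sum does not depend
    on the spins.\<close>
  have "- m * (x + y - u - v) / h + m * (x' + y' - u - v) / h = - m * ((y - x') - (y' - x)) / h"
    for m x y x' y' u v
    unfolding add_divide_distrib[symmetric] by (simp add: algebra_simps)
  then have "(F (l - 1) - F k) / qnum s (k - l + 1) + (F (k - 1) - F l) / qnum s (k - l - 1)
     = - qnum s (k + l) * ((T k - T (k - 1)) - (T l - T (l - 1))) / h"
    unfolding F1 F2 .
  also have "\<dots> = - qnum s (k + l) * (h * (qnum_plus s (k + l) * qnum s (k - l)))"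
    unfolding t3[OF H(3)] t3[OF H(4)] t4 right_diff_distrib[symmetric, of h] using h0 by simp
  finally show ?thesis by (simp add: h_def ac_simps)
qed

text \<open>Three-term recursion of the eigenvalues, a case of the product formula. It cancels the
  two-step paths that change k + l by two.\<close>

lemma qnum_plus_succ_pred:
  assumes "a \<in> half_ints"
  shows "(qpow s 1 + qpow s (- 1)) * qnum_plus s a = qnum_plus s (a + 1) + qnum_plus s (a - 1)"
proof -
  have "qdiff * qnum_plus s 1 = qpow s 1 + qpow s (- 1)" by (simp add: qnum_plus_def)
  from this[symmetric] show ?thesis
    unfolding qnum_plus_mult[OF assms half_ints_1, symmetric] by (simp add: ac_simps)
qed

text \<open>The coefficient of a two-step path that comes back to the initial value of k + l. The
  right sides cancel a factor of \<open>wt\<close> at the intermediate point.\<close>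

lemma qnum_plus_return:
  assumes "a \<in> half_ints"
  shows "2 * qnum_plus s a - (qpow s 1 + qpow s (- 1)) * qnum_plus s (a + 1) = - (qdiff * qnum s (a + 1))"
    and "2 * qnum_plus s a - (qpow s 1 + qpow s (- 1)) * qnum_plus s (a - 1) = qdiff * qnum s (a - 1)"
proof -
  have "qnum_plus s (a + 2) - qnum_plus s a = qdiff * (qnum s (a + 1) * qnum s 1)"
    by (rule qnum_plus_diff) (use assms in auto)
  then have *: "qdiff * qnum s (a + 1) = qnum_plus s (a + 2) - qnum_plus s a" by simp
  have "qnum_plus s a - qnum_plus s (a - 2) = qdiff * (qnum s (a - 1) * qnum s 1)"
    by (rule qnum_plus_diff) (use assms in auto)
  then have **: "qdiff * qnum s (a - 1) = qnum_plus s a - qnum_plus s (a - 2)" by simp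
  have ***: "(qpow s 1 + qpow s (- 1)) * qnum_plus s (a + 1) = qnum_plus s (a + 2) + qnum_plus s a"
    using qnum_plus_succ_pred[of "a + 1"] assms by (simp add: add.assoc)
  show
    "2 * qnum_plus s a - (qpow s 1 + qpow s (- 1)) * qnum_plus s (a + 1) = - (qdiff * qnum s (a + 1))"
    unfolding * *** by simp
  have ****: "(qpow s 1 + qpow s (- 1)) * qnum_plus s (a - 1) = qnum_plus s a + qnum_plus s (a - 2)"
    using qnum_plus_succ_pred[of "a - 1"] assms by simp
  show
    "2 * qnum_plus s a - (qpow s 1 + qpow s (- 1)) * qnum_plus s (a - 1) = qdiff * qnum s (a - 1)"
    unfolding ** **** by simp
qed

text \<open>In the relation linear in I32, a hop between eigenvectors with eigenvalues x and y is
  multiplied by x^2 - (q + 1/q) x y + y^2; this evaluates that factor.\<close>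

lemma qnum_plus_neighbours:
  assumes "a \<in> half_ints"
  shows "(qnum_plus s a)\<^sup>2 - (qpow s 1 + qpow s (- 1)) * (qnum_plus s a * qnum_plus s (a + 1))
    + (qnum_plus s (a + 1))\<^sup>2 = - 1"
proof -
  define h where "h = qdiff"
  define x where "x = qpow s a"
  define p where "p = qpow s 1"
  have *: "h \<noteq> 0" "x \<noteq> 0" "p \<noteq> 0" "h = p - inverse p"
    by (simp_all add: h_def x_def p_def flip: qpow_minus)
  have A: "qnum_plus s a = (x + inverse x) / h" "qnum_plus s (a + 1) = (x * p + inverse (x * p)) / h"
    using assms by (simp_all only: qnum_plus_def h_def x_def p_def qpow_add qpow_minus half_ints_add half_ints_1)
  have B: "qpow s 1 + qpow s (- 1) = p + inverse p" by (simp add: p_def qpow_minus)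
  have C: "(X / h)\<^sup>2 - c * (X / h * (Y / h)) + (Y / h)\<^sup>2 = (X\<^sup>2 - c * (X * Y) + Y\<^sup>2) / h\<^sup>2" for X Y c
    by (simp add: power_divide power2_eq_square add_divide_distrib diff_divide_distrib)
  have "(qnum_plus s a)\<^sup>2 - (qpow s 1 + qpow s (- 1)) * (qnum_plus s a * qnum_plus s (a + 1))
    + (qnum_plus s (a + 1))\<^sup>2 = ((x + inverse x)\<^sup>2 - (p + inverse p) * ((x + inverse x) * (x * p + inverse (x * p))) + (x * p + inverse (x * p))\<^sup>2) / h\<^sup>2"
    unfolding A B C ..
  also have "(x + inverse x)\<^sup>2 - (p + inverse p) * ((x + inverse x) * (x * p + inverse (x * p))) + (x * p + inverse (x * p))\<^sup>2 = - (h\<^sup>2)"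
  proof -
    \<comment> \<open>With the inverses as variables the identity is polynomial modulo x y = 1 and p
      r = 1.\<close>
    define y r where "y = inverse x" and "r = inverse p"
    have "x * y = 1" "p * r = 1" using * by (simp_all add: y_def r_def)
    then have "(x + y)\<^sup>2 - (p + r) * ((x + y) * (x * p + y * r)) + (x * p + y * r)\<^sup>2 = - ((p - r)\<^sup>2)"
      by algebra
    then show ?thesis unfolding y_def r_def *(4) inverse_mult_distrib .
  qed
  finally show ?thesis using *(1) by simp
qed

end

section \<open>The lattice and the hopping operation\<close>

lemma scale_apply: "scale c v x = c * v x"
  by (simp add: scale_def)

lemma linear_on_UNIV:
  assumes "linear_on UNIV L"
  shows "L (u + v) = L u + L v" "L (scale c v) = scale c (L v)" "L (u - v) = L u - L v"
proof -
  show add: "L (u + v) = L u + L v" and scale: "L (scale c v) = scale c (L v)" for u v c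
    using assms by (simp_all add: linear_on_def)
  have "L (u - v) = L (u + scale (- 1) v)" by (rule arg_cong[of _ _ L]) (simp add: scale_def fun_eq_iff)
  also have "\<dots> = L u - L v" by (simp add: add scale) (simp add: scale_def fun_eq_iff)
  finally show "L (u - v) = L u - L v" .
qed

text \<open>The last assumption says that exactly one of the half-integers j, j' is integral. Then k
  + l and k - l are never integers at lattice points, and the denominators of \<open>wt\<close> do
  not vanish.\<close>

locale spin_lattice = generic_root +
  fixes j j' :: rat
  assumes j_half [simp]: "j \<in> half_ints" and j'_half [simp]: "j' \<in> half_ints"
    and sum_not_Ints: "j + j' \<notin> \<int>"
begin

text \<open>A hop from an edge of the finite \<open>rect\<close> formally names a point outside it,
  with amplitude zero; the infinite \<open>lat\<close> contains these points as well.\<close>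

abbreviation lat :: "rat \<Rightarrow> rat \<Rightarrow> bool" where
  "lat k l \<equiv> k - j \<in> \<int> \<and> l - j' \<in> \<int>"

abbreviation rect :: "rat \<Rightarrow> rat \<Rightarrow> bool" where
  "rect k l \<equiv> lat k l \<and> \<bar>k\<bar> \<le> j \<and> \<bar>l\<bar> \<le> j'"

lemma lat_half_ints:
  assumes "lat k l"
  shows "k \<in> half_ints" "l \<in> half_ints"
  using half_ints_add[OF half_ints_Ints j_half, of "k - j"]
    half_ints_add[OF half_ints_Ints j'_half, of "l - j'"] assms by simp_all

lemma lat_not_Ints:
  assumes "lat k l"
  shows "k + l \<notin> \<int>" "k - l \<notin> \<int>"
proof -
  show "k + l \<notin> \<int>"
  proof
    assume "k + l \<in> \<int>"
    then have "(k + l) - (k - j) - (l - j') \<in> \<int>" using assms by (blast intro: Ints_diff)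
    then show False using sum_not_Ints by (simp add: algebra_simps)
  qed
  then show "k - l \<notin> \<int>"
    using Ints_add[of "k - l" "2 * l"] lat_half_ints[OF assms] by (auto simp: half_ints_def add.commute)
qed

lemma lat_shift:
  assumes "lat k l"
  shows "lat (k + 1) l" "lat (k - 1) l" "lat k (l + 1)" "lat k (l - 1)"
proof -
  have "(k - j) + 1 \<in> \<int>" "(k - j) - 1 \<in> \<int>" "(l - j') + 1 \<in> \<int>" "(l - j') - 1 \<in> \<int>"
    using assms by (auto intro: Ints_add Ints_diff)
  then show "lat (k + 1) l" "lat (k - 1) l" "lat k (l + 1)" "lat k (l - 1)"
    using assms by (simp_all add: algebra_simps)
qed

lemma lat_uminus:
  assumes "lat k l"
  shows "lat (- k) (- l)" "lat k (- l)"
proof -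
  have "- (k - j) - 2 * j \<in> \<int>" "- (l - j') - 2 * j' \<in> \<int>"
    using assms j_half j'_half unfolding half_ints_def by (blast intro: Ints_diff Ints_minus)+
  moreover have "- (k - j) - 2 * j = - k - j" "- (l - j') - 2 * j' = - l - j'" by simp_all
  ultimately show "lat (- k) (- l)" "lat k (- l)" using assms by metis+
qed

lemma qnum_lat_nonzero:
  assumes "lat k l"
  shows "qnum s (k + l) \<noteq> 0" "qnum s (k - l) \<noteq> 0"
  by (rule qnum_nonzero; use lat_half_ints[OF assms] lat_not_Ints[OF assms] in auto)+

text \<open>The generic formula for I32, as an operation on families of vectors rather than an
  operator: it can then be iterated and applied to rescaled families.\<close>

definition hop :: "(rat \<Rightarrow> rat \<Rightarrow> 'b \<Rightarrow> complex) \<Rightarrow> rat \<Rightarrow> rat \<Rightarrow> 'b \<Rightarrow> complex" where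
  "hop e k l = scale (\<i> * wt s k l)
     (scale (amp s j j' (- l)) (e k (l - 1)) - scale (amp s j j' l) (e k (l + 1))
      + scale (amp s j j' (- k)) (e (k - 1) l) - scale (amp s j j' k) (e (k + 1) l))"

lemma linear_hop:
  assumes "linear_on UNIV L"
  shows "L (hop e k l) = hop (\<lambda>k l. L (e k l)) k l"
  by (simp add: hop_def linear_on_UNIV[OF assms])

text \<open>The amplitude vanishes on every hop that leaves \<open>rect\<close>, so the values of
  the family outside do not matter.\<close>

lemma scale_amp_cong:
  assumes "rect k l" "\<And>k l. rect k l \<Longrightarrow> f k l = g k l"
  shows "scale (amp s j j' (- l)) (f k (l - 1)) = scale (amp s j j' (- l)) (g k (l - 1))"
    "scale (amp s j j' l) (f k (l + 1)) = scale (amp s j j' l) (g k (l + 1))"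
    "scale (amp s j j' (- k)) (f (k - 1) l) = scale (amp s j j' (- k)) (g (k - 1) l)"
    "scale (amp s j j' k) (f (k + 1) l) = scale (amp s j j' k) (g (k + 1) l)"
proof -
  have amp_zero: "amp s j j' x = 0" if "x = j \<or> x = j'" for x
    using that by (auto simp: amp_def)
  \<comment> \<open>Integrality of the difference turns x < a into x + 1 \<le> a.\<close>
  have step: "x + 1 \<le> a" if int: "x - a \<in> \<int>" and "x \<le> a" "x \<noteq> a" for x a :: rat
  proof -
    obtain n where n: "x - a = of_int n" using int by (rule Ints_cases)
    then have "of_int n < (0 :: rat)" using \<open>x \<le> a\<close> \<open>x \<noteq> a\<close> by simp
    then have "n + 1 \<le> 0" by simp
    then have "of_int (n + 1) \<le> (0 :: rat)" by (simp only: of_int_le_0_iff)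
    then show ?thesis using n by simp
  qed
  have k: "x + 1 \<le> j" if "lat x y" "x \<le> j" "x \<noteq> j" for x y using step that by auto
  have l: "y + 1 \<le> j'" if "lat x y" "y \<le> j'" "y \<noteq> j'" for x y using step that by auto
  note sh = lat_shift[of k l] and m = lat_uminus[of k l]
  show "scale (amp s j j' l) (f k (l + 1)) = scale (amp s j j' l) (g k (l + 1))"
  proof (cases "l = j'")
    case False
    then have "rect k (l + 1)" using l[of k l] assms(1) sh by (auto simp: abs_le_iff)
    then show ?thesis using assms(2) by simp
  qed (simp add: amp_zero scale_def)
  show "scale (amp s j j' k) (f (k + 1) l) = scale (amp s j j' k) (g (k + 1) l)"
  proof (cases "k = j")
    case False
    then have "rect (k + 1) l" using k[of k l] assms(1) sh by (auto simp: abs_le_iff)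
    then show ?thesis using assms(2) by simp
  qed (simp add: amp_zero scale_def)
  show "scale (amp s j j' (- l)) (f k (l - 1)) = scale (amp s j j' (- l)) (g k (l - 1))"
  proof (cases "- l = j'")
    case False
    then have "rect k (l - 1)" using l[of k "- l"] m assms(1) sh by (auto simp: abs_le_iff)
    then show ?thesis using assms(2) by simp
  qed (simp add: amp_zero scale_def)
  show "scale (amp s j j' (- k)) (f (k - 1) l) = scale (amp s j j' (- k)) (g (k - 1) l)"
  proof (cases "- k = j")
    case False
    then have "rect (k - 1) l" using k[of "- k" "- l"] m assms(1) sh by (auto simp: abs_le_iff)
    then show ?thesis using assms(2) by simp
  qed (simp add: amp_zero scale_def)
qed

lemma hop_cong:
  assumes "rect k l" "\<And>k l. rect k l \<Longrightarrow> f k l = g k l"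
  shows "hop f k l = hop g k l"
  unfolding hop_def using scale_amp_cong[of k l f g, OF assms] by simp

lemma hop_apply:
  "hop e k l p = \<i> * wt s k l *
     (amp s j j' (- l) * e k (l - 1) p - amp s j j' l * e k (l + 1) p
      + amp s j j' (- k) * e (k - 1) l p - amp s j j' k * e (k + 1) l p)"
  by (simp add: hop_def scale_def)

section \<open>The cubic relations between a hopping and a diagonal operator\<close>

context
  fixes A D :: "('b \<Rightarrow> complex) \<Rightarrow> 'b \<Rightarrow> complex" and e :: "rat \<Rightarrow> rat \<Rightarrow> 'b \<Rightarrow> complex"
    and \<epsilon> :: complex
  assumes linA: "linear_on UNIV A" and linD: "linear_on UNIV D"
    and eps: "\<epsilon>\<^sup>2 = 1"
    and A_e: "\<And>k l. rect k l \<Longrightarrow> A (e k l) = hop e k l"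
    and D_e: "\<And>k l. lat k l \<Longrightarrow> D (e k l) = scale (\<epsilon> * qnum_plus s (k + l)) (e k l)"
begin

text \<open>D stands for I21 or, on reflected vectors, for I43. Every hop changes k + l by one, so
  each of the four terms acquires the factor -1 of \<open>qnum_plus_neighbours\<close>.\<close>

lemma hop_cubic_linear:
  assumes kl: "rect k l"
  shows "A (D (D (e k l))) - scale (qpow s 1 + qpow s (- 1)) (D (A (D (e k l)))) + D (D (A (e k l)))
    = - A (e k l)"
proof
  fix p
  define Q where "Q = qpow s 1 + qpow s (- 1)"
  define \<mu> where "\<mu> = (\<lambda>k l. \<epsilon> * qnum_plus s (k + l))"
  have sA: "A (scale c v) = scale c (A v)" and sD: "D (scale c v) = scale c (D v)" for c v
    using linA linD by (auto simp: linear_on_def)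
  have sh: "lat k l" "lat (k + 1) l" "lat (k - 1) l" "lat k (l + 1)" "lat k (l - 1)"
    using kl lat_shift[of k l] by auto
  have 1: "A (D (D (e k l))) = scale (\<mu> k l * \<mu> k l) (hop e k l)"
    using sh kl by (simp add: D_e sA sD A_e \<mu>_def) (simp add: scale_def mult_ac)
  have 2: "D (A (D (e k l))) = scale (\<mu> k l) (hop (\<lambda>k l. scale (\<mu> k l) (e k l)) k l)"
    using sh kl by (simp add: D_e sA sD A_e linear_hop[OF linD]) (simp add: hop_def D_e \<mu>_def)
  have 3: "D (D (A (e k l))) = hop (\<lambda>k l. scale (\<mu> k l * \<mu> k l) (e k l)) k l"
    using sh kl by (simp add: A_e linear_hop[OF linD])
      (simp add: hop_def D_e sD \<mu>_def, simp add: scale_def mult_ac)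
  have N: "\<mu> x y * \<mu> x y - Q * (\<mu> x y * \<mu> u v) + \<mu> u v * \<mu> u v = - 1"
    if "lat x y" "lat u v" "u + v = x + y + 1 \<or> x + y = u + v + 1" for x y u v
  proof -
    have H: "x + y \<in> half_ints" "u + v \<in> half_ints" using that lat_half_ints by blast+
    have "\<mu> x y * \<mu> x y - Q * (\<mu> x y * \<mu> u v) + \<mu> u v * \<mu> u v = \<epsilon>\<^sup>2 *
      ((qnum_plus s (x + y))\<^sup>2 - Q * (qnum_plus s (x + y) * qnum_plus s (u + v)) + (qnum_plus s (u + v))\<^sup>2)"
      by (simp add: \<mu>_def power2_eq_square algebra_simps)
    also have "\<dots> = - 1"
      using that(3)
    proof
      assume "u + v = x + y + 1"
      then show ?thesis using qnum_plus_neighbours[OF H(1)] eps by (simp add: Q_def)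
    next
      assume "x + y = u + v + 1"
      then show ?thesis using qnum_plus_neighbours[OF H(2)] eps by (simp add: Q_def algebra_simps)
    qed
    finally show ?thesis .
  qed
  have M: "\<mu> k l * \<mu> k l * E - Q * (\<mu> k l * (\<mu> u v * E)) + \<mu> u v * \<mu> u v * E = - E"
    if "lat u v" "u + v = k + l + 1 \<or> k + l = u + v + 1" for u v E
  proof -
    have "\<mu> k l * \<mu> k l * E - Q * (\<mu> k l * (\<mu> u v * E)) + \<mu> u v * \<mu> u v * E
      = (\<mu> k l * \<mu> k l - Q * (\<mu> k l * \<mu> u v) + \<mu> u v * \<mu> u v) * E" by (simp add: algebra_simps)
    then show ?thesis using N[OF sh(1) that] by simp
  qed
  have M4: "\<mu> k l * \<mu> k l * e k (l - 1) p
      - Q * (\<mu> k l * (\<mu> k (l - 1) * e k (l - 1) p)) + \<mu> k (l - 1) * \<mu> k (l - 1) * e k (l - 1) p = - e k (l - 1) p"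
    "\<mu> k l * \<mu> k l * e k (l + 1) p
      - Q * (\<mu> k l * (\<mu> k (l + 1) * e k (l + 1) p)) + \<mu> k (l + 1) * \<mu> k (l + 1) * e k (l + 1) p = - e k (l + 1) p"
    "\<mu> k l * \<mu> k l * e (k - 1) l p
      - Q * (\<mu> k l * (\<mu> (k - 1) l * e (k - 1) l p)) + \<mu> (k - 1) l * \<mu> (k - 1) l * e (k - 1) l p = - e (k - 1) l p"
    "\<mu> k l * \<mu> k l * e (k + 1) l p
      - Q * (\<mu> k l * (\<mu> (k + 1) l * e (k + 1) l p)) + \<mu> (k + 1) l * \<mu> (k + 1) l * e (k + 1) l p = - e (k + 1) l p"
    by (rule M; use sh in auto)+
  \<comment> \<open>Regroups the three products by direction, so that \<open>M4\<close> applies to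
    each hop separately.\<close>
  have comb: "L * (c * (a1 * x1 - a2 * x2 + a3 * x3 - a4 * x4))
      - Q * (r * (c * (a1 * y1 - a2 * y2 + a3 * y3 - a4 * y4)))
      + c * (a1 * z1 - a2 * z2 + a3 * z3 - a4 * z4)
    = c * (a1 * (L * x1 - Q * (r * y1) + z1) - a2 * (L * x2 - Q * (r * y2) + z2)
      + a3 * (L * x3 - Q * (r * y3) + z3) - a4 * (L * x4 - Q * (r * y4) + z4))"
    for L c a1 a2 a3 a4 x1 x2 x3 x4 y1 y2 y3 y4 z1 z2 z3 z4 r :: complex
    by (simp add: algebra_simps)
  show "(A (D (D (e k l))) - scale (qpow s 1 + qpow s (- 1)) (D (A (D (e k l)))) + D (D (A (e k l)))) p
    = (- A (e k l)) p"
    unfolding 1 2 3 unfolding A_e[OF kl] Q_def[symmetric]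
    by (simp add: hop_apply scale_def comb M4) (simp add: algebra_simps)
qed

text \<open>A sum over two-step paths from (k, l). Those changing k + l by two have coefficient
  zero; those ending at (k + 1, l - 1) or (k - 1, l + 1) cancel in pairs; the closed ones are summed
  by \<open>amp_diagonal_identity\<close>.\<close>

lemma hop_cubic_quadratic:
  assumes kl: "rect k l"
  shows "D (A (A (e k l))) - scale (qpow s 1 + qpow s (- 1)) (A (D (A (e k l)))) + A (A (D (e k l)))
    = - D (e k l)"
proof
  fix p
  define Q where "Q = qpow s 1 + qpow s (- 1)"
  define \<mu> where "\<mu> = (\<lambda>k l. \<epsilon> * qnum_plus s (k + l))"
  define E where "E = (\<lambda>k l. e k l p)"
  have sA: "A (scale c v) = scale c (A v)" and sD: "D (scale c v) = scale c (D v)" for c v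
    using linA linD by (auto simp: linear_on_def)
  have sh: "lat k l" "lat (k + 1) l" "lat (k - 1) l" "lat k (l + 1)" "lat k (l - 1)"
    using kl lat_shift[of k l] by auto
  have hopD: "hop (\<lambda>k l. D (e k l)) x y = hop (\<lambda>k l. scale (\<mu> k l) (e k l)) x y" if "lat x y" for x y
    using lat_shift[OF that] by (simp add: hop_def D_e \<mu>_def)
  have 1: "D (A (A (e k l))) = hop (hop (\<lambda>k l. scale (\<mu> k l) (e k l))) k l"
  proof -
    have "D (A (A (e k l))) = hop (\<lambda>k l. D (A (e k l))) k l"
      using kl by (simp add: A_e linear_hop[OF linA] linear_hop[OF linD])
    \<comment> \<open>\<open>A_e\<close> is available only on \<open>rect\<close>;
      \<open>hop_cong\<close> makes that sufficient.\<close>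
    also have "\<dots> = hop (hop (\<lambda>k l. scale (\<mu> k l) (e k l))) k l"
      by (rule hop_cong[OF kl]) (simp add: A_e linear_hop[OF linD] hopD)
    finally show ?thesis .
  qed
  have 2: "A (D (A (e k l))) = hop (\<lambda>k l. scale (\<mu> k l) (hop e k l)) k l"
  proof -
    have "A (D (A (e k l))) = hop (\<lambda>k l. A (D (e k l))) k l"
      using kl by (simp add: A_e linear_hop[OF linA] linear_hop[OF linD])
    also have "\<dots> = hop (\<lambda>k l. scale (\<mu> k l) (hop e k l)) k l"
      by (rule hop_cong[OF kl]) (simp add: A_e D_e sA \<mu>_def)
    finally show ?thesis .
  qed
  have 3: "A (A (D (e k l))) = scale (\<mu> k l) (hop (hop e) k l)"
  proof -
    have "A (A (e k l)) = hop (hop e) k l"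
      using kl by (simp add: A_e linear_hop[OF linA]) (rule hop_cong[OF kl], simp add: A_e)
    then show ?thesis using sh by (simp add: D_e sA \<mu>_def)
  qed
  \<comment> \<open>H x y is the contribution of the intermediate point (x, y), with the three terms
    of the relation combined. A second hop from there gets the coefficient \<mu>(end) - Q
    \<mu>(middle) + \<mu>(start).\<close>
  define H where "H = (\<lambda>x y. hop (\<lambda>k l. scale (\<mu> k l) (e k l)) x y p - Q * (\<mu> x y * hop e x y p) + \<mu> k l * hop e x y p)"
  have H: "H x y = \<i> * wt s x y *
     (amp s j j' (- y) * ((\<mu> x (y - 1) - Q * \<mu> x y + \<mu> k l) * E x (y - 1))
    - amp s j j' y * ((\<mu> x (y + 1) - Q * \<mu> x y + \<mu> k l) * E x (y + 1))
    + amp s j j' (- x) * ((\<mu> (x - 1) y - Q * \<mu> x y + \<mu> k l) * E (x - 1) y)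
    - amp s j j' x * ((\<mu> (x + 1) y - Q * \<mu> x y + \<mu> k l) * E (x + 1) y))" for x y
    by (simp add: H_def hop_apply scale_def E_def algebra_simps)
  have lhs: "(D (A (A (e k l))) - scale (qpow s 1 + qpow s (- 1)) (A (D (A (e k l)))) + A (A (D (e k l)))) p
    = \<i> * wt s k l * (amp s j j' (- l) * H k (l - 1) - amp s j j' l * H k (l + 1)
      + amp s j j' (- k) * H (k - 1) l - amp s j j' k * H (k + 1) l)"
    unfolding 1 2 3 Q_def[symmetric]
    by (simp add: hop_apply[of _ k l] scale_def H_def algebra_simps)
  \<comment> \<open>In these coordinates the eigenvalue depends on m alone, and \<open>wt\<close>
    splits into a factor in m and one in n.\<close>
  define m n where "m = k + l" and "n = k - l"
  have mn: "m \<in> half_ints" "n \<in> half_ints" "m + 1 \<in> half_ints" "m - 1 \<in> half_ints"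
    using lat_half_ints[OF sh(1)] by (auto simp: m_def n_def)
  have up: "\<mu> k l - Q * (\<epsilon> * qnum_plus s (m + 1)) + \<mu> k l = - (\<epsilon> * qdiff * qnum s (m + 1))"
    "\<mu> k l - Q * (\<epsilon> * qnum_plus s (m - 1)) + \<mu> k l = \<epsilon> * qdiff * qnum s (m - 1)"
  proof -
    have "\<mu> k l - Q * (\<epsilon> * z) + \<mu> k l = \<epsilon> * (2 * qnum_plus s m - Q * z)" for z
      by (simp add: \<mu>_def m_def algebra_simps)
    then show "\<mu> k l - Q * (\<epsilon> * qnum_plus s (m + 1)) + \<mu> k l = - (\<epsilon> * qdiff * qnum s (m + 1))"
      "\<mu> k l - Q * (\<epsilon> * qnum_plus s (m - 1)) + \<mu> k l = \<epsilon> * qdiff * qnum s (m - 1)"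
      using qnum_plus_return[OF mn(1)] by (simp_all only: Q_def mult.assoc mult_minus_right)
  qed
  have straight: "\<epsilon> * qnum_plus s (m + 2) - Q * (\<epsilon> * qnum_plus s (m + 1)) + \<mu> k l = 0"
    "\<epsilon> * qnum_plus s (m - 2) - Q * (\<epsilon> * qnum_plus s (m - 1)) + \<mu> k l = 0"
  proof -
    have "Q * qnum_plus s (m + 1) = qnum_plus s (m + 2) + qnum_plus s m"
      "Q * qnum_plus s (m - 1) = qnum_plus s m + qnum_plus s (m - 2)"
      using qnum_plus_succ_pred[OF mn(3)] qnum_plus_succ_pred[OF mn(4)]
      by (simp_all add: Q_def add.assoc)
    then show "\<epsilon> * qnum_plus s (m + 2) - Q * (\<epsilon> * qnum_plus s (m + 1)) + \<mu> k l = 0"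
      "\<epsilon> * qnum_plus s (m - 2) - Q * (\<epsilon> * qnum_plus s (m - 1)) + \<mu> k l = 0"
      unfolding \<mu>_def m_def[symmetric] mult.left_commute[of Q \<epsilon>] 
      by (simp_all add: algebra_simps)
  qed
  have nz: "qnum s m \<noteq> 0" "qnum s n \<noteq> 0" "qnum s (m + 1) \<noteq> 0" "qnum s (m - 1) \<noteq> 0"
    "qnum s (n + 1) \<noteq> 0" "qnum s (n - 1) \<noteq> 0"
    using qnum_lat_nonzero[OF sh(1)] qnum_lat_nonzero[OF sh(2)] qnum_lat_nonzero[OF sh(3)]
    by (simp_all add: m_def n_def algebra_simps)
  define h where "h = qdiff"
  have h0: "h \<noteq> 0" by (simp add: h_def)
  have wts: "wt s k l = 1 / (qnum s m * qnum s n * h)"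
    "wt s k (l + 1) = 1 / (qnum s (m + 1) * qnum s (n - 1) * h)"
    "wt s k (l - 1) = 1 / (qnum s (m - 1) * qnum s (n + 1) * h)"
    "wt s (k + 1) l = 1 / (qnum s (m + 1) * qnum s (n + 1) * h)"
    "wt s (k - 1) l = 1 / (qnum s (m - 1) * qnum s (n - 1) * h)"
    by (simp_all add: wt_def m_def n_def h_def algebra_simps)
  have ls: "\<mu> k (l + 1) = \<epsilon> * qnum_plus s (m + 1)" "\<mu> (k + 1) l = \<epsilon> * qnum_plus s (m + 1)"
    "\<mu> k (l - 1) = \<epsilon> * qnum_plus s (m - 1)" "\<mu> (k - 1) l = \<epsilon> * qnum_plus s (m - 1)"
    "\<mu> k (l + 1 + 1) = \<epsilon> * qnum_plus s (m + 2)" "\<mu> (k + 1 + 1) l = \<epsilon> * qnum_plus s (m + 2)"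
    "\<mu> (k + 1) (l + 1) = \<epsilon> * qnum_plus s (m + 2)"
    "\<mu> k (l - 1 - 1) = \<epsilon> * qnum_plus s (m - 2)" "\<mu> (k - 1 - 1) l = \<epsilon> * qnum_plus s (m - 2)"
    "\<mu> (k - 1) (l - 1) = \<epsilon> * qnum_plus s (m - 2)"
    "\<mu> (k + 1) (l - 1) = \<mu> k l" "\<mu> (k - 1) (l + 1) = \<mu> k l"
    "\<mu> k (l + 1 - 1) = \<mu> k l" "\<mu> k (l - 1 + 1) = \<mu> k l"
    "\<mu> (k + 1 - 1) l = \<mu> k l" "\<mu> (k - 1 + 1) l = \<mu> k l"
    by (simp_all add: \<mu>_def m_def algebra_simps)
  have neg: "- (l + 1) = - l - 1" "- (k + 1) = - k - 1" by simp_all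
  \<comment> \<open>Of the four second hops two vanish by \<open>straight\<close>. In the other two,
    \<open>up\<close> cancels the m-factor of \<open>wt\<close> and only the denominator in n is
    left.\<close>
  have H1: "H k (l + 1) = - \<i> * \<epsilon> / qnum s (n - 1) *
      (amp s j j' (- l - 1) * E k l + amp s j j' (- k) * E (k - 1) (l + 1))"
    unfolding H ls straight up wts neg h_def[symmetric] using nz h0 by (simp add: field_simps)
  have H2: "H (k + 1) l = - \<i> * \<epsilon> / qnum s (n + 1) *
      (amp s j j' (- l) * E (k + 1) (l - 1) + amp s j j' (- k - 1) * E k l)"
    unfolding H ls straight up wts neg h_def[symmetric] using nz h0 by (simp add: field_simps)
  have H3: "H k (l - 1) = - \<i> * \<epsilon> / qnum s (n + 1) *
      (amp s j j' (l - 1) * E k l + amp s j j' k * E (k + 1) (l - 1))"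
    unfolding H ls straight up wts neg h_def[symmetric] using nz h0 by (simp add: field_simps)
  have H4: "H (k - 1) l = - \<i> * \<epsilon> / qnum s (n - 1) *
      (amp s j j' l * E (k - 1) (l + 1) + amp s j j' (k - 1) * E k l)"
    unfolding H ls straight up wts neg h_def[symmetric] using nz h0 by (simp add: field_simps)
  define F where "F = (\<lambda>x. amp s j j' x * amp s j j' (- x - 1))"
  have F: "amp s j j' l * amp s j j' (- l - 1) = F l" "amp s j j' k * amp s j j' (- k - 1) = F k"
    "amp s j j' (- l) * amp s j j' (l - 1) = F (l - 1)" "amp s j j' (- k) * amp s j j' (k - 1) = F (k - 1)"
    by (simp_all add: F_def)
  have "n + 1 \<noteq> 0" "n - 1 \<noteq> 0"
    using lat_not_Ints[OF sh(2)] lat_not_Ints[OF sh(3)] by (auto simp: n_def algebra_simps)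
  then have diag: "(F (l - 1) - F k) / qnum s (n + 1) + (F (k - 1) - F l) / qnum s (n - 1)
    = - (qnum_plus s m * qnum s m * qnum s n * h)"
    using amp_diagonal_identity[OF j_half j'_half lat_half_ints[OF sh(1)]]
    unfolding F_def m_def n_def h_def by blast
  \<comment> \<open>The two routes to each diagonal neighbour share the denominator in n and the
    amplitudes but have opposite signs, so only E k l survives.\<close>
  have "\<i> * wt s k l * (amp s j j' (- l) * H k (l - 1) - amp s j j' l * H k (l + 1)
      + amp s j j' (- k) * H (k - 1) l - amp s j j' k * H (k + 1) l)
    = wt s k l * \<epsilon> * E k l * ((F (l - 1) - F k) / qnum s (n + 1) + (F (k - 1) - F l) / qnum s (n - 1))"
    unfolding H1 H2 H3 H4 F[symmetric] diff_divide_distrib by (simp add: algebra_simps)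
  also have "\<dots> = - (\<epsilon> * qnum_plus s m * E k l)"
    unfolding diag wts using nz h0 by simp
  finally show "(D (A (A (e k l))) - scale (qpow s 1 + qpow s (- 1)) (A (D (A (e k l)))) + A (A (D (e k l)))) p
    = (- D (e k l)) p"
    unfolding lhs unfolding D_e[OF sh(1)] by (simp add: scale_def E_def m_def)
qed

end

end

subsection \<open>Folding the lattice\<close>

interpretation fun_module: module "scale :: complex \<Rightarrow> ('b \<Rightarrow> complex) \<Rightarrow> 'b \<Rightarrow> complex"
  by (rule module_scale)

section \<open>Index ranges and linear extension of operators\<close>

lemma descend_iff: "x \<in> descend a b \<longleftrightarrow> b \<le> x \<and> x \<le> a \<and> x - a \<in> \<int>"
proof
  assume "x \<in> descend a b"
  then show "b \<le> x \<and> x \<le> a \<and> x - a \<in> \<int>" by (auto simp: descend_def)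
next
  assume x: "b \<le> x \<and> x \<le> a \<and> x - a \<in> \<int>"
  then obtain n where n: "x - a = of_int n" by (auto elim: Ints_cases)
  then have "of_int n \<le> (0 :: rat)" using x by simp
  then have "x = a - of_nat (nat (- n))" using n by simp
  then show "x \<in> descend a b" using x unfolding descend_def by blast
qed

lemma finite_descend: "finite (descend a b)"
proof (rule finite_subset)
  show "descend a b \<subseteq> (\<lambda>n. a - of_nat n) ` {..nat \<lceil>a - b\<rceil>}"
  proof
    fix x assume "x \<in> descend a b"
    then obtain n where n: "b \<le> x" "x = a - of_nat n" by (auto simp: descend_def)
    then have "(of_int (int n) :: rat) \<le> of_int \<lceil>a - b\<rceil>"
      by (intro order_trans[OF _ le_of_int_ceiling]) simp
    then have "int n \<le> \<lceil>a - b\<rceil>" by (simp only: of_int_le_iff)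
    then show "x \<in> (\<lambda>n. a - of_nat n) ` {..nat \<lceil>a - b\<rceil>}" using n by auto
  qed
qed simp

lemma finite_idx: "finite (idx j j')"
  by (simp add: idx_def finite_descend)

lemma half_odd_pos: "x \<in> half_odd \<Longrightarrow> 0 < x \<Longrightarrow> 1/2 \<le> x"
proof -
  assume "x \<in> half_odd" "0 < x"
  then obtain n where n: "x - 1/2 = of_int n" by (auto simp: half_odd_def elim: Ints_cases)
  then have "(of_int (- 1) :: rat) < of_int n" using \<open>0 < x\<close> by simp
  then have "- 1 < n" by (simp only: of_int_less_iff)
  then have "(0 :: rat) \<le> of_int n" by simp
  then show ?thesis using n by simp
qed

lemma Ints_shift: "(x :: rat) - y \<in> \<int> \<Longrightarrow> x \<in> \<int> \<longleftrightarrow> y \<in> \<int>"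
  using Ints_diff[of x "x - y"] Ints_add[of "x - y" y] by auto

lemma half_odd_shift: "x - y \<in> \<int> \<Longrightarrow> x \<in> half_odd \<longleftrightarrow> y \<in> half_odd"
  using Ints_shift[of "x - 1/2" "y - 1/2"] by (simp add: half_odd_def)

lemma floor_uminus_not_Ints:
  assumes "(x :: rat) \<notin> \<int>"
  shows "\<lfloor>- x\<rfloor> = - \<lfloor>x\<rfloor> - 1"
proof (rule floor_unique)
  have "of_int \<lfloor>x\<rfloor> \<noteq> x" using assms Ints_of_int[of "\<lfloor>x\<rfloor>"] by metis
  then have "of_int \<lfloor>x\<rfloor> < x" using of_int_floor_le[of x] by linarith
  then show "- x < of_int (- \<lfloor>x\<rfloor> - 1) + 1" by simp
  show "of_int (- \<lfloor>x\<rfloor> - 1) \<le> - x" using floor_correct[of x] by simp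
qed

lemma extend_linearly_apply:
  "extend_linearly j j' F v x = (\<Sum>y\<in>idx j j'. v y * F (fst y) (snd y) x)"
proof -
  have "sum f A x = (\<Sum>y\<in>A. f y x)" for f :: "rat \<times> rat \<Rightarrow> rat \<times> rat \<Rightarrow> complex" and A
    by (induction A rule: infinite_finite_induct) auto
  then show ?thesis by (simp add: extend_linearly_def case_prod_beta scale_def)
qed

lemma linear_extend_linearly: "linear_on S (extend_linearly j j' F)"
  by (simp add: linear_on_def fun_eq_iff extend_linearly_apply scale_def algebra_simps
      sum.distrib sum_distrib_left)

lemma extend_linearly_ket:
  assumes "(k, l) \<in> idx j j'"
  shows "extend_linearly j j' F (ket j j' k l) = F k l"
proof
  fix x
  have "extend_linearly j j' F (ket j j' k l) x
      = (\<Sum>y\<in>idx j j'. if y = (k, l) then F k l x else 0)"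
    unfolding extend_linearly_apply by (rule sum.cong) (auto simp: ket_def)
  then show "extend_linearly j j' F (ket j j' k l) x = F k l x"
    using assms by (simp add: finite_idx)
qed

lemma ket_apply: "x \<in> idx j j' \<Longrightarrow> ket j j' k l x = (if x = (k, l) then 1 else 0)"
  by (auto simp: ket_def)

lemma extend_linearly_diagonal:
  "extend_linearly j j' (\<lambda>k l. scale (f k l) (ket j j' k l)) v x
    = (if x \<in> idx j j' then f (fst x) (snd x) * v x else 0)"
proof -
  have "extend_linearly j j' (\<lambda>k l. scale (f k l) (ket j j' k l)) v x
      = (\<Sum>y\<in>idx j j'. if y = x then f (fst x) (snd x) * v x else 0)"
    unfolding extend_linearly_apply by (rule sum.cong) (auto simp: ket_def scale_def)
  then show ?thesis by (simp add: finite_idx)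
qed

lemma span_ket:
  "fun_module.span {ket j j' k l | k l. (k, l) \<in> idx j j'} = {v. \<forall>x. x \<notin> idx j j' \<longrightarrow> v x = 0}"
  (is "?L = ?R")
proof
  have "fun_module.subspace ?R"
    by (rule fun_module.subspaceI) (auto simp: scale_def)
  then show "?L \<subseteq> ?R"
    by (intro fun_module.span_minimal) (auto simp: ket_def)
  show "?R \<subseteq> ?L"
  proof
    fix v assume v: "v \<in> ?R"
    have "v = extend_linearly j j' (\<lambda>k l. scale 1 (ket j j' k l)) v"
      using v by (intro ext) (simp only: extend_linearly_diagonal, auto)
    also have "\<dots> \<in> ?L"
      unfolding extend_linearly_def
    proof (rule fun_module.span_sum, clarify)
      fix k l assume "(k, l) \<in> idx j j'"
      then have "ket j j' k l \<in> ?L" by (blast intro: fun_module.span_base)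
      then show "scale (v (k, l)) (scale 1 (ket j j' k l)) \<in> ?L" by (intro fun_module.span_scale)
    qed
    finally show "v \<in> ?L" .
  qed
qed

text \<open>The relation is linear in v, so a spanning family suffices. Both the kets and the
  reflected vectors will serve as one.\<close>

lemma cubic_rel_span:
  assumes X: "linear_on UNIV X" and Y: "linear_on UNIV Y"
    and B: "\<And>v. v \<in> B \<Longrightarrow> X (Y (Y v)) - scale (q + inverse q) (Y (X (Y v))) + Y (Y (X v)) = - X v"
  shows "cubic_rel q (fun_module.span B) X Y"
proof -
  let ?P = "{v. X (Y (Y v)) - scale (q + inverse q) (Y (X (Y v))) + Y (Y (X v)) = - X v}"
  have zero: "L 0 = 0" if "linear_on UNIV L" for L :: "('b \<Rightarrow> complex) \<Rightarrow> 'b \<Rightarrow> complex"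
    using linear_on_UNIV(3)[OF that, of 0 0] by simp
  have "fun_module.subspace ?P"
  proof (rule fun_module.subspaceI)
    show "0 \<in> ?P" by (simp add: zero[OF X] zero[OF Y])
    show "x + y \<in> ?P" if "x \<in> ?P" "y \<in> ?P" for x y
    proof -
      have "X (Y (Y (x + y))) - scale (q + inverse q) (Y (X (Y (x + y)))) + Y (Y (X (x + y)))
        = (X (Y (Y x)) - scale (q + inverse q) (Y (X (Y x))) + Y (Y (X x)))
        + (X (Y (Y y)) - scale (q + inverse q) (Y (X (Y y))) + Y (Y (X y)))"
        by (simp add: linear_on_UNIV[OF X] linear_on_UNIV[OF Y] fun_module.scale_right_distrib algebra_simps)
      then show ?thesis using that by (simp add: linear_on_UNIV[OF X])
    qed
    show "scale c x \<in> ?P" if "x \<in> ?P" for c x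
    proof -
      have "X (Y (Y (scale c x))) - scale (q + inverse q) (Y (X (Y (scale c x)))) + Y (Y (X (scale c x)))
        = scale c (X (Y (Y x)) - scale (q + inverse q) (Y (X (Y x))) + Y (Y (X x)))"
        by (simp add: linear_on_UNIV[OF X] linear_on_UNIV[OF Y]) (simp add: scale_def fun_eq_iff algebra_simps)
      then show ?thesis using that by (simp add: linear_on_UNIV[OF X])
    qed
  qed
  then have "fun_module.span B \<subseteq> ?P"
    by (intro fun_module.span_minimal) (use B in auto)
  then show ?thesis by (auto simp: cubic_rel_def)
qed

text \<open>\<kappa> stays a parameter so that irreducibility and nonequivalence are proved at once
  for all nonzero values; the relations are proved for \<kappa> = 1.\<close>

locale nonclassical_data = generic_root s for s +
  fixes \<kappa> e1 e2 e3 :: complex and j j' :: rat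
  assumes kappa_nonzero: "\<kappa> \<noteq> 0"
    and params: "(e1, e2, e3, j, j') \<in> nonclassical_params"
begin

lemma signs: "e1 \<in> {1, - 1}" "e2 \<in> {1, - 1}" "e3 \<in> {1, - 1}" "0 \<le> j" "0 \<le> j'"
  using params by (auto simp: nonclassical_params_def)

lemma parity: "j \<in> half_odd \<and> j' \<in> \<int> \<and> j' \<notin> half_odd \<and> j \<notin> \<int>
    \<or> j \<notin> half_odd \<and> j \<in> \<int> \<and> j' \<in> half_odd \<and> j' \<notin> \<int>"
  using params half_odd_not_Ints unfolding nonclassical_params_def by blast

sublocale spin_lattice s j j'
proof
  show "j \<in> half_ints" "j' \<in> half_ints"
    using parity half_odd_half_ints half_ints_Ints by blast+
  show "j + j' \<notin> \<int>"
    using parity Ints_diff[of "j + j'" j] Ints_diff[of "j + j'" j'] by auto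
qed

text \<open>The tested coordinate is half-odd on the lattice, hence nonzero. So exactly one of (k,
  l) and (-k, -l) is selected, and \<open>idx\<close> is a fundamental domain of the rectangle under
  this reflection.\<close>

definition pos :: "rat \<Rightarrow> rat \<Rightarrow> bool" where
  "pos k l \<longleftrightarrow> (if j \<in> half_odd then 0 < k else 0 < l)"

lemma lat_parity:
  assumes "lat k l"
  shows "j \<in> half_odd \<Longrightarrow> k \<in> half_odd \<and> l \<in> \<int>" "j \<notin> half_odd \<Longrightarrow> k \<in> \<int> \<and> l \<in> half_odd"
proof -
  have "k \<in> half_odd \<longleftrightarrow> j \<in> half_odd" "l \<in> half_odd \<longleftrightarrow> j' \<in> half_odd" "k \<in> \<int> \<longleftrightarrow> j \<in> \<int>" "l \<in> \<int> \<longleftrightarrow> j' \<in> \<int>"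
    using assms half_odd_shift Ints_shift by blast+
  then show "j \<in> half_odd \<Longrightarrow> k \<in> half_odd \<and> l \<in> \<int>" "j \<notin> half_odd \<Longrightarrow> k \<in> \<int> \<and> l \<in> half_odd"
    using parity by blast+
qed

lemma idx_iff: "(k, l) \<in> idx j j' \<longleftrightarrow> rect k l \<and> pos k l"
proof (cases "j \<in> half_odd")
  case True
  have "1/2 \<le> k \<longleftrightarrow> 0 < k" if "k - j \<in> \<int>"
    using half_odd_pos[of k] half_odd_shift[OF that] True by auto
  then show ?thesis using True by (auto simp: idx_def descend_iff pos_def abs_le_iff)
next
  case False
  have "1/2 \<le> l \<longleftrightarrow> 0 < l" if "l - j' \<in> \<int>"
    using half_odd_pos[of l] half_odd_shift[OF that] False parity by auto
  then show ?thesis using False by (auto simp: idx_def descend_iff pos_def abs_le_iff)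
qed

lemma pos_uminus:
  assumes "lat k l"
  shows "pos (- k) (- l) \<longleftrightarrow> \<not> pos k l"
proof -
  have "0 \<notin> half_odd" using half_odd_not_Ints[of 0] by auto
  then show ?thesis using lat_parity[OF assms] by (auto simp: pos_def linorder_not_less less_le)
qed

abbreviation rep :: "(rat \<times> rat) gen_action" where
  "rep \<equiv> nonclassical \<kappa> s (e1, e2, e3, j, j')"

abbreviation kt :: "rat \<Rightarrow> rat \<Rightarrow> rat \<times> rat \<Rightarrow> complex" where
  "kt \<equiv> ket j j'"

lemma Sp_rep: "Sp rep = {v. \<forall>x. x \<notin> idx j j' \<longrightarrow> v x = 0}"
  by (simp add: span_ket)

lemma Sp_outside: "v \<in> Sp rep \<Longrightarrow> x \<notin> idx j j' \<Longrightarrow> v x = 0"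
  unfolding Sp_rep by blast

lemma subspace_Sp: "fun_module.subspace (Sp rep)"
  by (simp add: fun_module.subspace_span)

lemma ket_in_Sp: "kt k l \<in> Sp rep"
  unfolding Sp_rep by (auto simp: ket_def)

lemma linear_rep:
  "linear_on S (A21 rep)" "linear_on S (A32 rep)" "linear_on S (A43 rep)"
  by (simp_all add: linear_extend_linearly)

lemma A21_apply: "A21 rep v x = (if x \<in> idx j j' then e1 * qnum_plus s (fst x + snd x) * v x else 0)"
  by (simp add: extend_linearly_diagonal)

lemma A43_apply: "A43 rep v x = (if x \<in> idx j j' then e2 * qnum_plus s (fst x - snd x) * v x else 0)"
  by (simp add: extend_linearly_diagonal)

lemma A32_ket: "(k, l) \<in> idx j j' \<Longrightarrow> A32 rep (kt k l) = I32_ket \<kappa> s e3 j j' k l"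
  by (simp add: extend_linearly_ket)

lemma rep_closed: "A21 rep ` Sp rep \<subseteq> Sp rep" "A32 rep ` Sp rep \<subseteq> Sp rep" "A43 rep ` Sp rep \<subseteq> Sp rep"
proof -
  show "A21 rep ` Sp rep \<subseteq> Sp rep" "A43 rep ` Sp rep \<subseteq> Sp rep"
    unfolding Sp_rep image_subset_iff by (simp_all only: mem_Collect_eq A21_apply A43_apply) simp_all
  have "I32_ket \<kappa> s e3 j j' k l x = 0" if "x \<notin> idx j j'" for k l x
    using that by (simp add: I32_ket_def scale_def ket_def)
  then show "A32 rep ` Sp rep \<subseteq> Sp rep"
    unfolding Sp_rep image_subset_iff by (simp add: extend_linearly_apply)
qed

end

lemma half_odd_gt_1:
  assumes "x \<in> half_odd" "0 < x" "x \<noteq> 1/2"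
  shows "1 < x"
proof -
  obtain n where n: "x - 1/2 = of_int n" using assms(1) by (auto simp: half_odd_def elim: Ints_cases)
  have "1/2 \<le> x" using half_odd_pos assms by blast
  then have "0 \<le> (of_int n :: rat)" "n \<noteq> 0" using n assms(3) by auto
  then have "(1 :: rat) \<le> of_int n" by simp
  then show ?thesis using n by linarith
qed

lemma minus_one_powi_uminus: "(- 1) powi (- n) = ((- 1) powi n :: complex)"
  by (simp add: power_int_minus flip: power_int_inverse)

section \<open>Folded and reflected basis vectors\<close>

context nonclassical_data
begin

text \<open>\<open>fold_coeff k l\<close> is the \<open>c\<close> in \<open>|-k,-l\<rangle> = c |k,l\<rangle>\<close>, and \<open>folded k l\<close> is the image of the
  basis vector of the full lattice under this identification.\<close>

definition fold_coeff :: "rat \<Rightarrow> rat \<Rightarrow> complex" where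
  "fold_coeff k l = - \<i> * e3 * (- 1) powi \<lfloor>k + l\<rfloor>"

definition folded :: "rat \<Rightarrow> rat \<Rightarrow> rat \<times> rat \<Rightarrow> complex" where
  "folded k l = (if pos k l then kt k l else scale (fold_coeff (- k) (- l)) (kt (- k) (- l)))"

lemma e3_square: "e3 * e3 = 1"
  using signs(3) by auto

lemma fold_coeff_shift:
  "fold_coeff (k + 1) l = - fold_coeff k l" "fold_coeff (k - 1) l = - fold_coeff k l"
  "fold_coeff k (l + 1) = - fold_coeff k l" "fold_coeff k (l - 1) = - fold_coeff k l"
proof -
  have "\<lfloor>k + 1 + l\<rfloor> = \<lfloor>k + l\<rfloor> + 1" "\<lfloor>k + (l + 1)\<rfloor> = \<lfloor>k + l\<rfloor> + 1"
    "\<lfloor>k - 1 + l\<rfloor> = \<lfloor>k + l\<rfloor> - 1" "\<lfloor>k + (l - 1)\<rfloor> = \<lfloor>k + l\<rfloor> - 1"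
    by linarith+
  then show "fold_coeff (k + 1) l = - fold_coeff k l" "fold_coeff (k - 1) l = - fold_coeff k l"
    "fold_coeff k (l + 1) = - fold_coeff k l" "fold_coeff k (l - 1) = - fold_coeff k l"
    by (simp_all add: fold_coeff_def power_int_add power_int_diff)
qed

text \<open>As k + l is not an integer, the floors of k + l and -k - l add up to -1, so the two
  signs multiply to -1; this cancels the square of -\<i>. Folding twice is therefore the
  identity.\<close>

lemma fold_coeff_uminus:
  assumes "lat k l"
  shows "fold_coeff (- k) (- l) * fold_coeff k l = 1"
proof -
  have f: "\<lfloor>- k + - l\<rfloor> = - \<lfloor>k + l\<rfloor> - 1"
    using floor_uminus_not_Ints[OF lat_not_Ints(1)[OF assms]] by simp
  have "(- 1) powi (- n - 1) * (- 1) powi n = (- 1 :: complex)" for n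
    by (simp add: power_int_add[symmetric])
  then have "(- 1) powi \<lfloor>- k + - l\<rfloor> * (- 1) powi \<lfloor>k + l\<rfloor> = (- 1 :: complex)"
    unfolding f .
  then have "(\<i> * \<i>) * (e3 * e3) * ((- 1) powi \<lfloor>- k + - l\<rfloor> * (- 1) powi \<lfloor>k + l\<rfloor>) = 1"
    by (simp add: e3_square)
  then show ?thesis unfolding fold_coeff_def by (simp only: ac_simps mult_minus_left mult_minus_right minus_minus)
qed

lemma folded_reflect:
  assumes "lat k l"
  shows "folded k l = scale (fold_coeff (- k) (- l)) (folded (- k) (- l))"
proof (cases "pos k l")
  case True
  then show ?thesis
    using pos_uminus[OF assms] fold_coeff_uminus[OF assms] by (simp add: folded_def)
next
  case False
  then show ?thesis using pos_uminus[OF assms] by (simp add: folded_def)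
qed

lemma wt_uminus: "wt s (- k) (- l) = wt s k l" "wt s k (- l) = wt s k l"
proof -
  have "qnum s (- k + - l) = - qnum s (k + l)" "qnum s (- k - - l) = - qnum s (k - l)"
    using qnum_minus[of "k + l"] qnum_minus[of "k - l"] by (simp_all add: algebra_simps)
  then show "wt s (- k) (- l) = wt s k l" by (simp add: wt_def)
  show "wt s k (- l) = wt s k l" by (simp add: wt_def mult.commute)
qed

text \<open>The eigenvalue is even under (k, l) to (-k, -l), so it respects the identification; at
  points folding outside \<open>idx\<close> both sides vanish.\<close>

lemma A21_folded: "A21 rep (folded k l) = scale (e1 * qnum_plus s (k + l)) (folded k l)"
  using qnum_plus_minus[of "k + l"]
  by (auto simp: fun_eq_iff A21_apply folded_def ket_def scale_def simp del: nonclassical.simps)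

lemma A43_folded: "A43 rep (folded k l) = scale (e2 * qnum_plus s (k - l)) (folded k l)"
  using qnum_plus_minus[of "k - l"]
  by (auto simp: fun_eq_iff A43_apply folded_def ket_def scale_def simp del: nonclassical.simps)

text \<open>The boundary formulas are the generic one with the lower neighbour folded back: the
  coefficient -\<i> e3 (-1)^l, or its analogue with k, times the generic \<i> gives e3 (-1)^l. Hence
  \<kappa> = 1.\<close>

lemma I32_ket_eq_hop:
  assumes "\<kappa> = 1" and kl: "(k, l) \<in> idx j j'"
  shows "I32_ket \<kappa> s e3 j j' k l = hop folded k l"
proof -
  have lat: "lat k l" and p: "pos k l" using kl by (auto simp: idx_iff)
  note par = lat_parity[OF lat]
  consider "j \<in> half_odd" "k = 1/2" | "j \<notin> half_odd" "l = 1/2"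
    | "j \<in> half_odd" "k \<noteq> 1/2" | "j \<notin> half_odd" "l \<noteq> 1/2" by blast
  then show ?thesis
  proof cases
    case 1
    then obtain n where n: "l = of_int n" using par by (auto elim: Ints_cases)
    have "\<lfloor>1/2 + - (of_int n :: rat)\<rfloor> = - n" by linarith
    then have c: "fold_coeff (1/2) (- l) = - \<i> * e3 * (- 1) powi \<lfloor>l\<rfloor>"
      unfolding fold_coeff_def n by (simp add: minus_one_powi_uminus)
    \<comment> \<open>The minus sign in the boundary formula comes from [l - 1/2] =
      -[1/2 - l].\<close>
    have w: "- 1 / (qnum s (l + 1/2) * qnum s (l - 1/2) * qdiff) = wt s (1/2) l"
      unfolding wt_def using qnum_minus[of "l - 1/2"] by (simp add: add.commute)
    show ?thesis
      unfolding 1(2) I32_ket_def w hop_def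
      using 1(1) c by (simp add: folded_def pos_def amp_def assms(1))
        (simp add: fun_eq_iff scale_def algebra_simps)
  next
    case 2
    then obtain n where n: "k = of_int n" using par by (auto elim: Ints_cases)
    have "\<lfloor>- (of_int n :: rat) + 1/2\<rfloor> = - n" by linarith
    then have c: "fold_coeff (- k) (1/2) = - \<i> * e3 * (- 1) powi \<lfloor>k\<rfloor>"
      unfolding fold_coeff_def n by (simp add: minus_one_powi_uminus)
    show ?thesis
      unfolding 2(2) I32_ket_def wt_def[symmetric] hop_def
      using 2(1) c parity by (simp add: folded_def pos_def amp_def assms(1))
        (simp add: fun_eq_iff scale_def algebra_simps)
  next
    case 3
    \<comment> \<open>A positive half-odd number other than 1/2 exceeds 1, so the lower neighbour
      needs no folding.\<close>
    then have "0 < k" "0 < k - 1" using p par half_odd_gt_1[of k] by (auto simp: pos_def)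
    then show ?thesis
      unfolding I32_ket_def wt_def[symmetric] hop_def
      using 3 parity by (simp add: folded_def pos_def amp_def)
        (simp add: fun_eq_iff scale_def algebra_simps)
  next
    case 4
    then have "0 < l" "0 < l - 1" using p par half_odd_gt_1[of l] by (auto simp: pos_def)
    then show ?thesis
      unfolding I32_ket_def wt_def[symmetric] hop_def
      using 4 parity by (simp add: folded_def pos_def amp_def)
        (simp add: fun_eq_iff scale_def algebra_simps)
  qed
qed

text \<open>Reflection exchanges steps up and down, which reverses the sign of the hopping formula;
  the sign change of \<open>fold_coeff\<close> at each step compensates.\<close>

lemma A32_folded:
  assumes "\<kappa> = 1" and kl: "rect k l"
  shows "A32 rep (folded k l) = hop folded k l"
proof (cases "pos k l")
  case True
  then have i: "(k, l) \<in> idx j j'" using kl by (simp add: idx_iff)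
  then show ?thesis using A32_ket[OF i] I32_ket_eq_hop[OF assms(1) i] True by (simp add: folded_def)
next
  case False
  have lat: "lat k l" using kl by blast
  define c where "c = fold_coeff (- k) (- l)"
  have i: "(- k, - l) \<in> idx j j'" using kl False lat_uminus[OF lat] pos_uminus[OF lat] by (simp add: idx_iff)
  have "A32 rep (folded k l) = scale c (A32 rep (kt (- k) (- l)))"
    using False linear_on_UNIV(2)[OF linear_rep(2)] by (simp add: folded_def c_def del: nonclassical.simps)
  also have "\<dots> = scale c (hop folded (- k) (- l))"
    using A32_ket[OF i] I32_ket_eq_hop[OF assms(1) i] by simp
  also have "\<dots> = hop folded k l"
  proof -
    have m: "- (k + 1) = - k - 1" "- (k - 1) = - k + 1" "- (l + 1) = - l - 1" "- (l - 1) = - l + 1"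
      by simp_all
    have f: "folded (k + 1) l = scale (- c) (folded (- k - 1) (- l))"
      "folded (k - 1) l = scale (- c) (folded (- k + 1) (- l))"
      "folded k (l + 1) = scale (- c) (folded (- k) (- l - 1))"
      "folded k (l - 1) = scale (- c) (folded (- k) (- l + 1))"
      using lat_shift[OF lat] by (simp_all only: folded_reflect m fold_coeff_shift c_def)
    show ?thesis
      unfolding hop_def f wt_uminus(1) by (simp add: fun_eq_iff scale_def algebra_simps)
  qed
  finally show ?thesis .
qed

text \<open>Reflecting \<open>l\<close> with alternating signs preserves the hopping formula and exchanges
  \<open>I\<^sub>2\<^sub>1\<close> with \<open>I\<^sub>4\<^sub>3\<close>.\<close>

definition reflected :: "rat \<Rightarrow> rat \<Rightarrow> rat \<times> rat \<Rightarrow> complex" where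
  "reflected k l = scale ((- 1) powi \<lfloor>l\<rfloor>) (folded k (- l))"

lemma A32_reflected:
  assumes "\<kappa> = 1" and kl: "rect k l"
  shows "A32 rep (reflected k l) = hop reflected k l"
proof -
  have r: "rect k (- l)" using kl lat_uminus by auto
  have m: "- (l + 1) = - l - 1" "- (l - 1) = - l + 1" by simp_all
  have f: "(- 1) powi \<lfloor>l + 1\<rfloor> = - ((- 1) powi \<lfloor>l\<rfloor> :: complex)" "(- 1) powi \<lfloor>l - 1\<rfloor> = - ((- 1) powi \<lfloor>l\<rfloor> :: complex)"
    by (simp_all add: power_int_add power_int_diff)
  have "A32 rep (reflected k l) = scale ((- 1) powi \<lfloor>l\<rfloor>) (hop folded k (- l))"
    unfolding reflected_def linear_on_UNIV(2)[OF linear_rep(2)] A32_folded[OF assms(1) r] ..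
  also have "\<dots> = hop reflected k l"
    unfolding hop_def reflected_def m f wt_uminus(2) by (simp add: fun_eq_iff scale_def algebra_simps)
  finally show ?thesis .
qed

lemma A43_reflected: "A43 rep (reflected k l) = scale (e2 * qnum_plus s (k + l)) (reflected k l)"
  unfolding reflected_def linear_on_UNIV(2)[OF linear_rep(3)] A43_folded
  by (simp add: scale_def fun_eq_iff)

theorem representation:
  assumes "\<kappa> = 1"
  shows "is_representation (s\<^sup>2) rep"
proof -
  let ?B = "{kt k l | k l. (k, l) \<in> idx j j'}"
  have Sp: "Sp rep = fun_module.span ?B" by simp
  have Q: "qpow s 1 + qpow s (- 1) = s\<^sup>2 + inverse (s\<^sup>2)"
    by (simp add: qpow_minus) (simp add: qpow_def)
  have e: "e1\<^sup>2 = 1" "e2\<^sup>2 = 1" using signs by (auto simp: power2_eq_square)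
  \<comment> \<open>The two hopping lemmas serve all four relations: I21 with the folded family, I43
    with the reflected one.\<close>
  note q1 = hop_cubic_quadratic[OF linear_rep(2) linear_rep(1) e(1) A32_folded[OF assms] A21_folded, unfolded Q]
  note q2 = hop_cubic_linear[OF linear_rep(2) linear_rep(1) e(1) A32_folded[OF assms] A21_folded, unfolded Q]
  note q3 = hop_cubic_quadratic[OF linear_rep(2) linear_rep(3) e(2) A32_reflected[OF assms] A43_reflected, unfolded Q]
  note q4 = hop_cubic_linear[OF linear_rep(2) linear_rep(3) e(2) A32_reflected[OF assms] A43_reflected, unfolded Q]
  let ?B' = "{reflected k l | k l. rect k l}"
  have ket_folded: "\<exists>k l. rect k l \<and> v = folded k l" if "v \<in> ?B" for v
    using that by (auto simp: idx_iff folded_def)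
  \<comment> \<open>Negating l maps \<open>rect\<close> to itself, so each ket is a nonzero multiple
    of a reflected vector.\<close>
  have span_reflected: "Sp rep \<subseteq> fun_module.span ?B'"
    unfolding Sp
  proof (rule fun_module.span_minimal)
    show "?B \<subseteq> fun_module.span ?B'"
    proof
      fix v assume "v \<in> ?B"
      then obtain k l where kl: "rect k l" "v = folded k l" using ket_folded by blast
      have "rect k (- l)" using kl lat_uminus by auto
      then have "scale (inverse ((- 1) powi \<lfloor>- l\<rfloor>)) (reflected k (- l)) \<in> fun_module.span ?B'"
        by (blast intro: fun_module.span_scale fun_module.span_base)
      also have "scale (inverse ((- 1) powi \<lfloor>- l\<rfloor>)) (reflected k (- l)) = v"
        by (simp add: kl(2) reflected_def)
      finally show "v \<in> fun_module.span ?B'" .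
    qed
  qed (rule fun_module.subspace_span)
  have mono: "cubic_rel q (Sp rep) X Y" if "cubic_rel q (fun_module.span ?B') X Y" for q X Y
    using that span_reflected unfolding cubic_rel_def by blast
  have "cubic_rel (s\<^sup>2) (Sp rep) (A21 rep) (A32 rep)"
    unfolding Sp
  proof (rule cubic_rel_span[OF linear_rep(1,2)])
    fix v assume "v \<in> ?B"
    then obtain k l where kl: "rect k l" "v = folded k l" using ket_folded by blast
    show "A21 rep (A32 rep (A32 rep v))
        - scale (s\<^sup>2 + inverse (s\<^sup>2)) (A32 rep (A21 rep (A32 rep v)))
        + A32 rep (A32 rep (A21 rep v)) = - A21 rep v" unfolding kl(2) by (rule q1) (use kl(1) in simp_all)
  qed
  moreover have "cubic_rel (s\<^sup>2) (Sp rep) (A32 rep) (A21 rep)"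
    unfolding Sp
  proof (rule cubic_rel_span[OF linear_rep(2,1)])
    fix v assume "v \<in> ?B"
    then obtain k l where kl: "rect k l" "v = folded k l" using ket_folded by blast
    show "A32 rep (A21 rep (A21 rep v))
        - scale (s\<^sup>2 + inverse (s\<^sup>2)) (A21 rep (A32 rep (A21 rep v)))
        + A21 rep (A21 rep (A32 rep v)) = - A32 rep v" unfolding kl(2) by (rule q2) (use kl(1) in simp_all)
  qed
  moreover have "cubic_rel (s\<^sup>2) (Sp rep) (A43 rep) (A32 rep)"
  proof (rule mono, rule cubic_rel_span[OF linear_rep(3,2)])
    fix v assume "v \<in> ?B'"
    then obtain k l where kl: "rect k l" "v = reflected k l" by blast
    show "A43 rep (A32 rep (A32 rep v))
        - scale (s\<^sup>2 + inverse (s\<^sup>2)) (A32 rep (A43 rep (A32 rep v)))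
        + A32 rep (A32 rep (A43 rep v)) = - A43 rep v" unfolding kl(2) by (rule q3) (use kl(1) in simp_all)
  qed
  moreover have "cubic_rel (s\<^sup>2) (Sp rep) (A32 rep) (A43 rep)"
  proof (rule mono, rule cubic_rel_span[OF linear_rep(2,3)])
    fix v assume "v \<in> ?B'"
    then obtain k l where kl: "rect k l" "v = reflected k l" by blast
    show "A32 rep (A43 rep (A43 rep v))
        - scale (s\<^sup>2 + inverse (s\<^sup>2)) (A43 rep (A32 rep (A43 rep v)))
        + A43 rep (A43 rep (A32 rep v)) = - A32 rep v" unfolding kl(2) by (rule q4) (use kl(1) in simp_all)
  qed
  moreover have "A21 rep (A43 rep v) = A43 rep (A21 rep v)" for v
    by (auto simp: fun_eq_iff A21_apply A43_apply simp del: nonclassical.simps)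
  ultimately show ?thesis
    unfolding is_representation_def using subspace_Sp linear_rep rep_closed by blast
qed

end

subsection \<open>Irreducibility\<close>

lemma descend_connected:
  assumes step: "\<And>z. z \<in> descend a b \<Longrightarrow> z + 1 \<in> descend a b \<Longrightarrow> P z \<longleftrightarrow> P (z + 1)"
    and "x \<in> descend a b"
  shows "P x \<longleftrightarrow> P a"
proof -
  have "b \<le> a - of_nat n \<Longrightarrow> P (a - of_nat n) \<longleftrightarrow> P a" for n
  proof (induction n)
    case (Suc n)
    have eq: "a - of_nat n = a - of_nat (Suc n) + 1" by simp
    have "a - of_nat (Suc n) \<in> descend a b" "a - of_nat n \<in> descend a b"
      using Suc.prems by (simp_all add: descend_iff)
    then have "P (a - of_nat (Suc n)) \<longleftrightarrow> P (a - of_nat n)" using step unfolding eq by blast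
    then show ?case using Suc by simp
  qed simp
  then show ?thesis using assms(2) by (auto simp: descend_def)
qed

section \<open>Joint spectrum and matrix entries\<close>

context generic_root
begin

text \<open>The eigenvalues determine k + l and k - l up to sign; the four choices of signs are the
  four alternatives.\<close>

lemma joint_eigenvalues_eq:
  assumes H: "k \<in> half_ints" "l \<in> half_ints" "k' \<in> half_ints" "l' \<in> half_ints"
    and e: "e1 \<in> {1, - 1}" "e2 \<in> {1, - 1}" "e1' \<in> {1, - 1}" "e2' \<in> {1, - 1}"
    and eq: "e1 * qnum_plus s (k + l) = e1' * qnum_plus s (k' + l')"
      "e2 * qnum_plus s (k - l) = e2' * qnum_plus s (k' - l')"
  shows "e1 = e1'" "e2 = e2'"
    "(k', l') = (k, l) \<or> (k', l') = (- k, - l) \<or> (k', l') = (l, k) \<or> (k', l') = (- l, - k)"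
proof -
  have a: "e1 = e1' \<and> (k + l = k' + l' \<or> k + l = - (k' + l'))"
    by (rule qnum_plus_eq) (use H e eq in auto)
  have b: "e2 = e2' \<and> (k - l = k' - l' \<or> k - l = - (k' - l'))"
    by (rule qnum_plus_eq) (use H e eq in auto)
  show "e1 = e1'" "e2 = e2'" using a b by blast+
  consider "k + l = k' + l'" "k - l = k' - l'" | "k + l = k' + l'" "k - l = - (k' - l')"
    | "k + l = - (k' + l')" "k - l = k' - l'" | "k + l = - (k' + l')" "k - l = - (k' - l')"
    using a b by blast
  then show "(k', l') = (k, l) \<or> (k', l') = (- k, - l) \<or> (k', l') = (l, k) \<or> (k', l') = (- l, - k)"
  proof cases
    case 1
    then have "k' = k" "l' = l" by linarith+
    then show ?thesis by simp
  next
    case 2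
    then have "k' = l" "l' = k" by linarith+
    then show ?thesis by simp
  next
    case 3
    then have "k' = - l" "l' = - k" by linarith+
    then show ?thesis by simp
  next
    case 4
    then have "k' = - k" "l' = - l" by linarith+
    then show ?thesis by simp
  qed
qed

end

context nonclassical_data
begin

text \<open>Of the alternatives in \<open>joint_eigenvalues_eq\<close>, (-k, -l) is excluded by
  \<open>pos\<close> and the two swaps by parity, since one fixed coordinate is half-odd and the
  other integral.\<close>

lemma joint_spectrum_simple:
  assumes x: "(k, l) \<in> idx j j'" and y: "(k', l') \<in> idx j j'"
    and eq: "e1 * qnum_plus s (k + l) = e1 * qnum_plus s (k' + l')"
      "e2 * qnum_plus s (k - l) = e2 * qnum_plus s (k' - l')"
  shows "(k', l') = (k, l)"
proof -
  have lat: "lat k l" "lat k' l'" and p: "pos k l" "pos k' l'" using x y by (auto simp: idx_iff)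
  have swap: False if "lat a b" "lat c d" "a - d \<in> \<int> \<or> a + d \<in> \<int>" for a b c d
  proof -
    have "a \<in> half_odd \<and> d \<in> \<int> \<or> a \<in> \<int> \<and> d \<in> half_odd"
      using lat_parity[OF that(1)] lat_parity[OF that(2)] by blast
    then have "a \<notin> \<int> \<and> d \<in> \<int> \<or> a \<in> \<int> \<and> d \<notin> \<int>" using half_odd_not_Ints by blast
    then show False
      using that(3) Ints_add[of "a - d" d] Ints_diff[of "a + d" d] Ints_diff[of "a + d" a] Ints_diff[of a "a - d"]
      by auto
  qed
  have "(k', l') = (k, l) \<or> (k', l') = (- k, - l) \<or> (k', l') = (l, k) \<or> (k', l') = (- l, - k)"
    by (rule joint_eigenvalues_eq(3)[OF lat_half_ints[OF lat(1)] lat_half_ints[OF lat(2)] signs(1,2,1,2) eq])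
  moreover have "(k', l') \<noteq> (- k, - l)" using pos_uminus[OF lat(1)] p by auto
  moreover have "(k', l') \<noteq> (l, k)" using swap[OF lat(2) lat(1)] by auto
  moreover have "(k', l') \<noteq> (- l, - k)" using swap[OF lat(2) lat(1)] by auto
  ultimately show ?thesis by blast
qed

lemma amp_nonzero:
  assumes "x \<in> half_ints" "x \<noteq> j" "x \<noteq> j'"
  shows "amp s j j' x \<noteq> 0"
  unfolding amp_def mult_eq_0_iff de_Morgan_disj
  by (intro conjI qnum_nonzero) (use assms in auto)

lemma wt_nonzero: "lat k l \<Longrightarrow> wt s k l \<noteq> 0"
  using qnum_lat_nonzero by (simp add: wt_def)

text \<open>Merges the three cases of the definition, so that matrix entries can be read off for any
  \<kappa>; at a boundary the folded term replaces a step down.\<close>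

lemma I32_ket_uniform:
  "I32_ket \<kappa> s e3 j j' k l = scale (wt s k l)
     (scale (- \<i> * amp s j j' l) (kt k (l + 1)) + scale (- \<i> * amp s j j' k) (kt (k + 1) l)
      + (if j' \<in> half_odd \<and> l = 1/2
         then scale (\<kappa> * e3 * (- 1) powi \<lfloor>k\<rfloor> * amp s j j' (- (1/2))) (kt (- k) (1/2))
         else scale (\<i> * amp s j j' (- l)) (kt k (l - 1)))
      + (if j \<in> half_odd \<and> k = 1/2
         then scale (\<kappa> * e3 * (- 1) powi \<lfloor>l\<rfloor> * amp s j j' (- (1/2))) (kt (1/2) (- l))
         else scale (\<i> * amp s j j' (- k)) (kt (k - 1) l)))"
proof -
  consider "j \<in> half_odd" "j' \<notin> half_odd" "k = 1/2" | "j \<notin> half_odd" "j' \<in> half_odd" "l = 1/2"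
    | "\<not> (j \<in> half_odd \<and> k = 1/2)" "\<not> (j' \<in> half_odd \<and> l = 1/2)"
    using parity by blast
  then show ?thesis
  proof cases
    case 1
    have w: "- 1 / (qnum s (l + 1/2) * qnum s (l - 1/2) * qdiff) = wt s (1/2) l"
      unfolding wt_def using qnum_minus[of "l - 1/2"] by (simp add: add.commute)
    show ?thesis
      unfolding 1(3) I32_ket_def w using 1(1,2)
      by (simp add: amp_def) (simp add: fun_eq_iff scale_def algebra_simps)
  next
    case 2
    show ?thesis
      unfolding 2(3) I32_ket_def wt_def[symmetric] using 2(1,2)
      by (simp add: amp_def) (simp add: fun_eq_iff scale_def algebra_simps)
  next
    case 3
    show ?thesis
      unfolding I32_ket_def wt_def[symmetric] if_not_P[OF 3(1)] if_not_P[OF 3(2)]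
      by (simp add: amp_def) (simp add: fun_eq_iff scale_def algebra_simps)
  qed
qed

lemma I32_ket_neighbour:
  assumes kl: "(k, l) \<in> idx j j'"
  shows "(k, l + 1) \<in> idx j j' \<Longrightarrow> I32_ket \<kappa> s e3 j j' k l (k, l + 1) \<noteq> 0"
    "(k, l - 1) \<in> idx j j' \<Longrightarrow> I32_ket \<kappa> s e3 j j' k l (k, l - 1) \<noteq> 0"
    "(k + 1, l) \<in> idx j j' \<Longrightarrow> I32_ket \<kappa> s e3 j j' k l (k + 1, l) \<noteq> 0"
    "(k - 1, l) \<in> idx j j' \<Longrightarrow> I32_ket \<kappa> s e3 j j' k l (k - 1, l) \<noteq> 0"
proof -
  have lat: "lat k l" and p: "pos k l" using kl by (auto simp: idx_iff)
  have H: "k \<in> half_ints" "l \<in> half_ints" using lat_half_ints[OF lat] .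
  note par = lat_parity[OF lat]
  have w: "wt s k l \<noteq> 0" using wt_nonzero[OF lat] .
  \<comment> \<open>\<open>amp\<close> also has a zero at the other spin; parity keeps the
    coordinates away from it.\<close>
  have ne: "l \<noteq> j" "- l \<noteq> j" "k \<noteq> j'" "- k \<noteq> j'"
  proof -
    have "l - j' \<in> \<int>" "j' - l \<in> \<int>" using lat Ints_minus[of "l - j'"] by auto
    moreover have "k - j \<in> \<int>" "k + l \<notin> \<int>" "k - l \<notin> \<int>" using lat lat_not_Ints[OF lat] by auto
    ultimately show "l \<noteq> j" "- l \<noteq> j" "k \<noteq> j'" "- k \<noteq> j'"
      by (auto simp: algebra_simps)
  qed
  have half: "1/2 \<notin> (\<int> :: rat set)" "- (1/2) \<notin> (\<int> :: rat set)"
    using half_odd_not_Ints[OF half_in_half_odd] by (auto simp only: minus_in_Ints_iff)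
  \<comment> \<open>The boundary term lands at -l and could disturb the entry at l + 1 or l - 1 only
    for l = -1/2 or l = 1/2, but l is an integer here.\<close>
  have flip: "- l \<noteq> l + 1" "- l \<noteq> l - 1" if "j \<in> half_odd"
  proof -
    have "l \<in> \<int>" using par that by blast
    then have "l \<noteq> 1/2" "l \<noteq> - (1/2)" using half by metis+
    then show "- l \<noteq> l + 1" "- l \<noteq> l - 1" by linarith+
  qed
  have flip': "- k \<noteq> k + 1" "- k \<noteq> k - 1" if "j \<notin> half_odd"
  proof -
    have "k \<in> \<int>" using par that by blast
    then have "k \<noteq> 1/2" "k \<noteq> - (1/2)" using half by metis+
    then show "- k \<noteq> k + 1" "- k \<noteq> k - 1" by linarith+
  qed
  show "I32_ket \<kappa> s e3 j j' k l (k, l + 1) \<noteq> 0" if i: "(k, l + 1) \<in> idx j j'"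
  proof -
    have "l \<noteq> j'" using i by (auto simp: idx_iff)
    then have a: "amp s j j' l \<noteq> 0" using ne H by (intro amp_nonzero) auto
    have "I32_ket \<kappa> s e3 j j' k l (k, l + 1) = wt s k l * (- \<i> * amp s j j' l)"
      unfolding I32_ket_uniform using flip parity by (auto simp: scale_def ket_apply[OF i])
    then show ?thesis using a w by simp
  qed
  show "I32_ket \<kappa> s e3 j j' k l (k, l - 1) \<noteq> 0" if i: "(k, l - 1) \<in> idx j j'"
  proof -
    have "- l \<noteq> j'" using i by (auto simp: idx_iff)
    then have a: "amp s j j' (- l) \<noteq> 0" using ne H by (intro amp_nonzero) auto
    have b: "\<not> (j' \<in> half_odd \<and> l = 1/2)" using i parity by (auto simp: idx_iff pos_def)
    have "I32_ket \<kappa> s e3 j j' k l (k, l - 1) = wt s k l * (\<i> * amp s j j' (- l))"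
      unfolding I32_ket_uniform if_not_P[OF b] using flip by (auto simp: scale_def ket_apply[OF i])
    then show ?thesis using a w by simp
  qed
  show "I32_ket \<kappa> s e3 j j' k l (k + 1, l) \<noteq> 0" if i: "(k + 1, l) \<in> idx j j'"
  proof -
    have "k \<noteq> j" using i by (auto simp: idx_iff)
    then have a: "amp s j j' k \<noteq> 0" using ne H by (intro amp_nonzero) auto
    have "I32_ket \<kappa> s e3 j j' k l (k + 1, l) = wt s k l * (- \<i> * amp s j j' k)"
      unfolding I32_ket_uniform using flip' parity by (auto simp: scale_def ket_apply[OF i])
    then show ?thesis using a w by simp
  qed
  show "I32_ket \<kappa> s e3 j j' k l (k - 1, l) \<noteq> 0" if i: "(k - 1, l) \<in> idx j j'"
  proof -
    have "- k \<noteq> j" using i by (auto simp: idx_iff)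
    then have a: "amp s j j' (- k) \<noteq> 0" using ne H by (intro amp_nonzero) auto
    have b: "\<not> (j \<in> half_odd \<and> k = 1/2)" using i parity by (auto simp: idx_iff pos_def)
    have "I32_ket \<kappa> s e3 j j' k l (k - 1, l) = wt s k l * (\<i> * amp s j j' (- k))"
      unfolding I32_ket_uniform if_not_P[OF b] using flip' parity by (auto simp: scale_def ket_apply[OF i])
    then show ?thesis using a w by simp
  qed
qed

text \<open>The boundary index that the boundary reflection fixes; there the term with e3 becomes a
  diagonal entry of I32.\<close>

definition base :: "rat \<times> rat" where
  "base = (if j \<in> half_odd then (1/2, 0) else (0, 1/2))"

lemma base_in_idx: "base \<in> idx j j'"
proof -
  have "1/2 \<le> x \<and> 1/2 - x \<in> \<int>" if "x \<in> half_odd" "0 \<le> x" for x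
  proof -
    have "x \<noteq> 0" using half_odd_not_Ints[OF that(1)] by auto
    then have "1/2 \<le> x" using that by (intro half_odd_pos) auto
    moreover have "- (x - 1/2) \<in> \<int>" using that(1) unfolding half_odd_def by (intro Ints_minus) simp
    ultimately show ?thesis by simp
  qed
  then show ?thesis using parity signs by (auto simp: base_def idx_iff pos_def)
qed

text \<open>The factor in front of e3 does not involve e3 and is nonzero, because -1/2 differs from
  the nonnegative j and j'. So the entry determines e3.\<close>

lemma I32_ket_base:
  "I32_ket \<kappa> s e3 j j' (fst base) (snd base) base
    = wt s (fst base) (snd base) * \<kappa> * amp s j j' (- (1/2)) * e3" (is ?diag)
  "wt s (fst base) (snd base) * \<kappa> * amp s j j' (- (1/2)) \<noteq> 0"
proof -
  have "lat (fst base) (snd base)" using base_in_idx idx_iff[of "fst base" "snd base"] by simp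
  then have w: "wt s (fst base) (snd base) \<noteq> 0" by (rule wt_nonzero)
  have a: "amp s j j' (- (1/2)) \<noteq> 0"
    by (rule amp_nonzero) (use signs in \<open>auto simp: half_ints_def\<close>)
  show ?diag
    unfolding I32_ket_uniform using parity base_in_idx
    by (auto simp: scale_def ket_apply base_def)
  show "wt s (fst base) (snd base) * \<kappa> * amp s j j' (- (1/2)) \<noteq> 0"
    using w a kappa_nonzero by simp
qed

text \<open>Induction on the other support points: X - f y, with X one of I21, I43, removes the
  coordinate y and keeps the one at (k, l) nonzero.\<close>

lemma projection:
  assumes W: "fun_module.subspace W" "W \<subseteq> Sp rep" "A21 rep ` W \<subseteq> W" "A43 rep ` W \<subseteq> W"
    and w: "w \<in> W" and x: "(k, l) \<in> idx j j'" "w (k, l) \<noteq> 0"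
  shows "kt k l \<in> W"
proof -
  have "kt k l \<in> W"
    if "finite S" "(k, l) \<notin> S" "S \<subseteq> idx j j'" "w \<in> W" "w (k, l) \<noteq> 0" "\<And>z. z \<notin> insert (k, l) S \<Longrightarrow> w z = 0" for S w
    using that
  proof (induction S arbitrary: w rule: finite_induct)
    case empty
    have "scale (1 / w (k, l)) w = kt k l"
      using empty x by (auto simp: scale_def ket_def fun_eq_iff)
    then show ?case using fun_module.subspace_scale[OF W(1) empty(3)] by metis
  next
    case (insert y S)
    \<comment> \<open>By simplicity of the joint spectrum, at least one of the two diagonal
      operators separates (k, l) from y.\<close>
    obtain f X where X: "X \<in> {A21 rep, A43 rep}" "\<And>v z. X v z = (if z \<in> idx j j' then f z * v z else 0)"
      and f: "f (k, l) \<noteq> f y"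
    proof -
      have "e1 * qnum_plus s (k + l) \<noteq> e1 * qnum_plus s (fst y + snd y)
          \<or> e2 * qnum_plus s (k - l) \<noteq> e2 * qnum_plus s (fst y - snd y)"
        using joint_spectrum_simple[OF x(1), of "fst y" "snd y"] insert.prems by auto
      then show thesis
      proof
        assume "e1 * qnum_plus s (k + l) \<noteq> e1 * qnum_plus s (fst y + snd y)"
        then show thesis using A21_apply by (intro that[of "A21 rep" "\<lambda>z. e1 * qnum_plus s (fst z + snd z)"]) auto
      next
        assume "e2 * qnum_plus s (k - l) \<noteq> e2 * qnum_plus s (fst y - snd y)"
        then show thesis using A43_apply by (intro that[of "A43 rep" "\<lambda>z. e2 * qnum_plus s (fst z - snd z)"]) auto
      qed
    qed
    define w' where "w' = X w - scale (f y) w"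
    have "X w \<in> W" using X(1) W insert.prems by blast
    then have w'W: "w' \<in> W"
      unfolding w'_def using W(1) insert.prems
      by (intro fun_module.subspace_diff fun_module.subspace_scale)
    have w'z: "w' z = (f z - f y) * w z" for z
      using Sp_outside[of w z] insert.prems(3) W(2) unfolding w'_def by (auto simp: X(2) scale_def algebra_simps)
    show ?case
    proof (rule insert.IH[OF _ _ w'W])
      show "w' (k, l) \<noteq> 0" using w'z f insert.prems by simp
      show "w' z = 0" if "z \<notin> insert (k, l) S" for z
        using w'z insert.prems(5)[of z] that by (cases "z = y") auto
    qed (use insert.prems in auto)
  qed
  from this[of "idx j j' - {(k, l)}" w] show ?thesis
    using w x W(2) finite_idx Sp_outside by blast
qed

lemma irreducible: "irreducible_action rep"
  unfolding irreducible_action_def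
proof (intro conjI allI impI)
  have "kt (fst base) (snd base) base = 1" using base_in_idx by (simp add: ket_def)
  then have "kt (fst base) (snd base) \<noteq> 0" by (metis zero_fun_apply zero_neq_one)
  then show "Sp rep \<noteq> {0}" using ket_in_Sp by blast
next
  fix W assume "fun_module.subspace W \<and> W \<subseteq> Sp rep \<and> (\<forall>X\<in>{A21 rep, A32 rep, A43 rep}. X ` W \<subseteq> W)"
  then have W: "fun_module.subspace W" "W \<subseteq> Sp rep" "A21 rep ` W \<subseteq> W" "A43 rep ` W \<subseteq> W" "A32 rep ` W \<subseteq> W"
    by auto
  show "W = {0} \<or> W = Sp rep"
  proof (cases "W = {0}")
    case False
    then obtain w where w: "w \<in> W" "w \<noteq> 0" using fun_module.subspace_0[OF W(1)] by blast
    then obtain x where "w x \<noteq> 0" by (auto simp: fun_eq_iff)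
    moreover have "x \<in> idx j j'" using w W(2) \<open>w x \<noteq> 0\<close> Sp_outside by blast
    ultimately have start: "kt (fst x) (snd x) \<in> W" "(fst x, snd x) \<in> idx j j'"
      using projection[OF W(1-4) w(1), of "fst x" "snd x"] by auto
    have step: "kt k' l' \<in> W"
      if "kt k l \<in> W" "(k, l) \<in> idx j j'" "(k', l') \<in> idx j j'" "I32_ket \<kappa> s e3 j j' k l (k', l') \<noteq> 0" for k l k' l'
    proof -
      have "I32_ket \<kappa> s e3 j j' k l \<in> W" using A32_ket[OF that(2)] W(5) that(1) by (metis image_subset_iff)
      then show ?thesis using projection[OF W(1-4)] that by blast
    qed
    have stepk: "kt k l \<in> W \<longleftrightarrow> kt (k + 1) l \<in> W" if "(k, l) \<in> idx j j'" "(k + 1, l) \<in> idx j j'" for k l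
      using step[OF _ that I32_ket_neighbour(3)[OF that]]
        step[OF _ that(2,1)] I32_ket_neighbour(4)[OF that(2)] that by auto
    have stepl: "kt k l \<in> W \<longleftrightarrow> kt k (l + 1) \<in> W" if "(k, l) \<in> idx j j'" "(k, l + 1) \<in> idx j j'" for k l
      using step[OF _ that I32_ket_neighbour(1)[OF that]]
        step[OF _ that(2,1)] I32_ket_neighbour(2)[OF that(2)] that by auto
    obtain b b' where idx: "idx j j' = descend j b \<times> descend j' b'"
      unfolding idx_def by (cases "j \<in> half_odd") auto
    \<comment> \<open>Every ket is linked to the top corner, first along k at fixed l, then along l
      at k = j.\<close>
    have corner: "kt k l \<in> W \<longleftrightarrow> kt j j' \<in> W" if "(k, l) \<in> idx j j'" for k l
    proof -
      have kl: "k \<in> descend j b" "l \<in> descend j' b'" using that idx by auto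
      have "j \<in> descend j b" using kl(1) by (auto simp: descend_iff)
      have "kt k l \<in> W \<longleftrightarrow> kt j l \<in> W"
        by (rule descend_connected[OF _ kl(1), where P = "\<lambda>k. kt k l \<in> W"]) (rule stepk; use kl idx in auto)
      also have "\<dots> \<longleftrightarrow> kt j j' \<in> W"
        by (rule descend_connected[OF _ kl(2), where P = "\<lambda>l. kt j l \<in> W"])
          (rule stepl; use \<open>j \<in> descend j b\<close> idx in auto)
      finally show ?thesis .
    qed
    have "Sp rep \<subseteq> W"
      using corner start W(1) by simp (intro fun_module.span_minimal; blast)
    then show ?thesis using W(2) by blast
  qed simp
qed

end

subsection \<open>Nonequivalence\<close>

text \<open>The witness is the inverse of the intertwiner; invariance of \<open>Sp R\<close> allows
  it to be cancelled against T on the vectors X (U w).\<close>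

lemma equivalent_actions_sym:
  assumes eq: "equivalent_actions R R'"
    and sub: "fun_module.subspace (Sp R)"
    and closed: "\<forall>X\<in>{A21 R, A32 R, A43 R}. X ` Sp R \<subseteq> Sp R"
  shows "equivalent_actions R' R"
proof -
  obtain T where lin: "linear_on (Sp R) T" and bij: "bij_betw T (Sp R) (Sp R')"
    and com: "\<And>v. v \<in> Sp R \<Longrightarrow> T (A21 R v) = A21 R' (T v) \<and> T (A32 R v) = A32 R' (T v) \<and> T (A43 R v) = A43 R' (T v)"
    using eq unfolding equivalent_actions_def by blast
  define U where "U = the_inv_into (Sp R) T"
  have inj: "inj_on T (Sp R)" using bij by (simp add: bij_betw_def)
  have U: "U w \<in> Sp R" "T (U w) = w" if "w \<in> Sp R'" for w
    using that bij bij_betw_the_inv_into[OF bij] unfolding U_def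
    by (auto simp: bij_betw_def f_the_inv_into_f_bij_betw[OF bij])
  have UT: "U (T v) = v" if "v \<in> Sp R" for v
    using that inj unfolding U_def by (rule the_inv_into_f_f[rotated])
  have "linear_on (Sp R') U"
    unfolding linear_on_def
  proof (intro conjI ballI allI)
    fix u v assume "u \<in> Sp R'" "v \<in> Sp R'"
    then have "u + v = T (U u + U v)" "U u + U v \<in> Sp R"
      using lin U sub by (auto simp: linear_on_def fun_module.subspace_add)
    then show "U (u + v) = U u + U v" using UT by simp
  next
    fix c v assume "v \<in> Sp R'"
    then have "scale c v = T (scale c (U v))" "scale c (U v) \<in> Sp R"
      using lin U sub by (auto simp: linear_on_def fun_module.subspace_scale)
    then show "U (scale c v) = scale c (U v)" using UT by simp
  qed
  moreover have "bij_betw U (Sp R') (Sp R)"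
    unfolding U_def by (rule bij_betw_the_inv_into[OF bij])
  moreover have "U (X' w) = X (U w)"
    if "w \<in> Sp R'" "X \<in> {A21 R, A32 R, A43 R}" "\<And>v. v \<in> Sp R \<Longrightarrow> T (X v) = X' (T v)" for w X X'
  proof -
    have "X' w = T (X (U w))" using that U by simp
    moreover have "X (U w) \<in> Sp R" using closed U that by blast
    ultimately show ?thesis using UT by simp
  qed
  ultimately show ?thesis
    unfolding equivalent_actions_def using com by (intro exI[of _ U]) auto
qed

locale intertwined_pair =
  R: nonclassical_data s \<kappa> e1 e2 e3 j j' + R': nonclassical_data s \<kappa> f1 f2 f3 i i'
  for s \<kappa> e1 e2 e3 j j' f1 f2 f3 i i' +
  fixes T :: "(rat \<times> rat \<Rightarrow> complex) \<Rightarrow> rat \<times> rat \<Rightarrow> complex"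
  assumes lin: "linear_on (Sp R.rep) T" and bij: "bij_betw T (Sp R.rep) (Sp R'.rep)"
    and com21: "\<And>v. v \<in> Sp R.rep \<Longrightarrow> T (A21 R.rep v) = A21 R'.rep (T v)"
    and com32: "\<And>v. v \<in> Sp R.rep \<Longrightarrow> T (A32 R.rep v) = A32 R'.rep (T v)"
    and com43: "\<And>v. v \<in> Sp R.rep \<Longrightarrow> T (A43 R.rep v) = A43 R'.rep (T v)"
begin

lemma T_scale: "v \<in> Sp R.rep \<Longrightarrow> T (scale c v) = scale c (T v)"
  using lin by (simp add: linear_on_def)

lemma T_add: "u \<in> Sp R.rep \<Longrightarrow> v \<in> Sp R.rep \<Longrightarrow> T (u + v) = T u + T v"
  using lin by (simp add: linear_on_def)

lemma T_in: "v \<in> Sp R.rep \<Longrightarrow> T v \<in> Sp R'.rep"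
  using bij by (auto simp: bij_betw_def)

lemma T_zero: "T 0 = 0"
  using T_scale[OF fun_module.subspace_0[OF R.subspace_Sp], of 0]
  by (simp only: fun_module.scale_zero_left)

lemma T_ket_nonzero:
  assumes "(k, l) \<in> idx j j'"
  shows "T (R.kt k l) \<noteq> 0"
proof
  assume "T (R.kt k l) = 0"
  with T_zero have "R.kt k l = 0"
    using bij R.ket_in_Sp fun_module.subspace_0[OF R.subspace_Sp]
    unfolding bij_betw_def inj_on_def by metis
  then have "R.kt k l (k, l) = 0" by simp
  then show False using assms by (simp add: ket_def)
qed

text \<open>T maps a joint eigenvector to a joint eigenvector, and a diagonal operator fixes the
  eigenvalue at every nonzero coordinate.\<close>

lemma T_ket_support:
  assumes x: "(k, l) \<in> idx j j'" and nz: "T (R.kt k l) (k', l') \<noteq> 0"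
  shows "(k', l') \<in> idx i i'" "e1 * qnum_plus s (k + l) = f1 * qnum_plus s (k' + l')"
    "e2 * qnum_plus s (k - l) = f2 * qnum_plus s (k' - l')"
proof -
  show y: "(k', l') \<in> idx i i'" using R'.Sp_outside[OF T_in[OF R.ket_in_Sp]] nz by blast
  have "A21 R.rep (R.kt k l) = scale (e1 * qnum_plus s (k + l)) (R.kt k l)"
    "A43 R.rep (R.kt k l) = scale (e2 * qnum_plus s (k - l)) (R.kt k l)"
    using x by (simp_all add: extend_linearly_ket)
  then have "scale (e1 * qnum_plus s (k + l)) (T (R.kt k l)) = A21 R'.rep (T (R.kt k l))"
    "scale (e2 * qnum_plus s (k - l)) (T (R.kt k l)) = A43 R'.rep (T (R.kt k l))"
    using com21[OF R.ket_in_Sp] com43[OF R.ket_in_Sp] T_scale[OF R.ket_in_Sp] by metis+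
  then have "scale (e1 * qnum_plus s (k + l)) (T (R.kt k l)) (k', l') = A21 R'.rep (T (R.kt k l)) (k', l')"
    "scale (e2 * qnum_plus s (k - l)) (T (R.kt k l)) (k', l') = A43 R'.rep (T (R.kt k l)) (k', l')"
    by simp_all
  then show "e1 * qnum_plus s (k + l) = f1 * qnum_plus s (k' + l')"
    "e2 * qnum_plus s (k - l) = f2 * qnum_plus s (k' - l')"
    unfolding R'.A21_apply R'.A43_apply using y nz by (simp_all add: scale_def)
qed

lemma corner_in_idx: "(j, j') \<in> idx j j'"
proof -
  have "0 < j" if "j \<in> half_odd" using that R.signs half_odd_not_Ints[of 0] by (auto simp: less_le)
  moreover have "0 < j'" if "j' \<in> half_odd" using that R.signs half_odd_not_Ints[of 0] by (auto simp: less_le)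
  ultimately show ?thesis using R.signs R.parity by (auto simp: R.idx_iff R.pos_def)
qed

text \<open>The image of the corner ket is supported at points whose absolute coordinates are j and
  j' in some order and bounded by i and i'. If they are swapped, the orderings of the spins still
  give both inequalities.\<close>

lemma signs_and_bounds:
  assumes ord: "j' \<le> j" "i' \<le> i"
  shows "e1 = f1" "e2 = f2" "j \<le> i" "j' \<le> i'"
proof -
  obtain k' l' where nz: "T (R.kt j j') (k', l') \<noteq> 0"
    using T_ket_nonzero[OF corner_in_idx] by (auto simp: fun_eq_iff)
  note supp = T_ket_support[OF corner_in_idx nz]
  have lat: "R'.lat k' l'" and b: "\<bar>k'\<bar> \<le> i" "\<bar>l'\<bar> \<le> i'" using supp(1) by (auto simp: R'.idx_iff)
  note eig = R.joint_eigenvalues_eq[OF R.j_half R.j'_half R'.lat_half_ints[OF lat] R.signs(1,2) R'.signs(1,2) supp(2,3)]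
  show "e1 = f1" "e2 = f2" using eig(1,2) .
  have "\<bar>k'\<bar> = j \<and> \<bar>l'\<bar> = j' \<or> \<bar>k'\<bar> = j' \<and> \<bar>l'\<bar> = j" using eig(3) R.signs by auto
  then show "j \<le> i" "j' \<le> i'" using b ord by auto
qed

end

context nonclassical_data
begin

lemma equivalent_imp_signs_and_bounds:
  assumes "nonclassical_data s \<kappa> f1 f2 f3 i i'"
    and "equivalent_actions rep (nonclassical \<kappa> s (f1, f2, f3, i, i'))"
    and "j' \<le> j" "i' \<le> i"
  shows "e1 = f1" "e2 = f2" "j \<le> i" "j' \<le> i'"
proof -
  interpret R': nonclassical_data s \<kappa> f1 f2 f3 i i' by fact
  obtain T where "linear_on (Sp rep) T" "bij_betw T (Sp rep) (Sp R'.rep)"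
    "\<forall>v\<in>Sp rep. T (A21 rep v) = A21 R'.rep (T v) \<and> T (A32 rep v) = A32 R'.rep (T v)
       \<and> T (A43 rep v) = A43 R'.rep (T v)"
    using assms(2) unfolding equivalent_actions_def by blast
  then interpret P: intertwined_pair s \<kappa> e1 e2 e3 j j' f1 f2 f3 i i' T
    by unfold_locales blast+
  show "e1 = f1" "e2 = f2" "j \<le> i" "j' \<le> i'" using P.signs_and_bounds assms(3,4) by auto
qed

text \<open>By the simple joint spectrum T is diagonal in the kets, so it preserves the diagonal
  entries of I32; the one at \<open>base\<close> shows the third sign.\<close>

lemma equivalent_imp_third_sign:
  assumes "nonclassical_data s \<kappa> e1 e2 f3 j j'"
    and "equivalent_actions rep (nonclassical \<kappa> s (e1, e2, f3, j, j'))"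
  shows "e3 = f3"
proof -
  interpret R': nonclassical_data s \<kappa> e1 e2 f3 j j' by fact
  obtain T where "linear_on (Sp rep) T" "bij_betw T (Sp rep) (Sp R'.rep)"
    "\<forall>v\<in>Sp rep. T (A21 rep v) = A21 R'.rep (T v) \<and> T (A32 rep v) = A32 R'.rep (T v)
       \<and> T (A43 rep v) = A43 R'.rep (T v)"
    using assms(2) unfolding equivalent_actions_def by blast
  then interpret P: intertwined_pair s \<kappa> e1 e2 e3 j j' e1 e2 f3 j j' T
    by unfold_locales blast+
  define k l where "k = fst base" and "l = snd base"
  have base: "base = (k, l)" by (simp add: k_def l_def)
  have kl: "(k, l) \<in> idx j j'" using base_in_idx base by simp
  define c where "c = T (kt k l) (k, l)"
  have off: "T (kt a b) y = 0" if "(a, b) \<in> idx j j'" "y \<noteq> (a, b)" for a b y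
  proof (rule ccontr)
    assume nz: "T (kt a b) y \<noteq> 0"
    obtain a' b' where y: "y = (a', b')" by fastforce
    have "(a', b') = (a, b)"
      using joint_spectrum_simple[OF that(1) P.T_ket_support[OF that(1) nz[unfolded y]]] .
    then show False using that(2) y by simp
  qed
  have c0: "c \<noteq> 0"
  proof
    assume "c = 0"
    then have "T (kt k l) y = 0" for y using off[OF kl] by (cases "y = (k, l)") (auto simp: c_def)
    then show False using P.T_ket_nonzero[OF kl] by (auto simp: fun_eq_iff)
  qed
  \<comment> \<open>Both sides are linear in u, so the kets suffice, where \<open>off\<close>
    applies.\<close>
  have diag: "T u (k, l) = c * u (k, l)" if "u \<in> Sp rep" for u
  proof -
    let ?P = "{u \<in> Sp rep. T u (k, l) = c * u (k, l)}"
    have "fun_module.subspace ?P"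
      using subspace_Sp P.T_zero
      by (intro fun_module.subspaceI)
        (auto simp: P.T_add P.T_scale fun_module.subspace_0 fun_module.subspace_add
          fun_module.subspace_scale algebra_simps scale_apply simp del: nonclassical.simps)
    moreover have "kt a b \<in> ?P" if "(a, b) \<in> idx j j'" for a b
    proof (cases "(a, b) = (k, l)")
      case True
      then show ?thesis using kl ket_in_Sp by (simp add: c_def ket_def del: nonclassical.simps)
    next
      case False
      then show ?thesis using off[OF that, of "(k, l)"] ket_in_Sp by (auto simp: ket_def simp del: nonclassical.simps)
    qed
    ultimately have "fun_module.span {kt a b | a b. (a, b) \<in> idx j j'} \<subseteq> ?P"
      by (intro fun_module.span_minimal) blast+
    then show ?thesis using that by auto
  qed
  have Tk: "T (kt k l) = scale c (kt k l)"
  proof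
    fix y
    show "T (kt k l) y = scale c (kt k l) y"
      using off[OF kl, of y] kl by (cases "y = (k, l)") (auto simp: c_def scale_def ket_def)
  qed
  have "c * I32_ket \<kappa> s e3 j j' k l (k, l) = T (A32 rep (kt k l)) (k, l)"
    unfolding A32_ket[OF kl, symmetric]
    by (rule diag[symmetric]) (use rep_closed(2) ket_in_Sp in blast)
  also have "\<dots> = A32 R'.rep (scale c (kt k l)) (k, l)"
    using P.com32[OF ket_in_Sp] Tk by metis
  also have "\<dots> = c * I32_ket \<kappa> s f3 j j' k l (k, l)"
    using linear_on_UNIV(2)[OF R'.linear_rep(2)] R'.A32_ket[OF kl] by (simp add: scale_def)
  finally have "I32_ket \<kappa> s e3 j j' k l (k, l) = I32_ket \<kappa> s f3 j j' k l (k, l)" using c0 by simp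
  moreover have "R'.base = base" by (simp add: base_def R'.base_def)
  ultimately show ?thesis
    using I32_ket_base R'.I32_ket_base by (simp add: base)
qed

end

text \<open>The relations are asserted for \<kappa> = 1, since with the printed constant \<i> they
  fail already for j = 1/2, j' = 0. The remaining claims cover both constants.\<close>

theorem theorem3:
  fixes q s :: complex
  assumes "q \<noteq> 0"
    and "\<forall>n::nat. n > 0 \<longrightarrow> q ^ n \<noteq> 1"
    and "s\<^sup>2 = q"
  shows "(\<forall>p\<in>ordered_params. is_representation q (nonclassical 1 s p)) \<and>
    (\<forall>\<kappa>\<in>{\<i>, 1}.
       (\<forall>p\<in>ordered_params. irreducible_action (nonclassical \<kappa> s p)) \<and>
       (\<forall>p\<in>ordered_params. \<forall>p'\<in>ordered_params. p \<noteq> p' \<longrightarrow>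
          \<not> equivalent_actions (nonclassical \<kappa> s p) (nonclassical \<kappa> s p')))"
proof -
  have root: "generic_root s"
  proof
    show "s \<noteq> 0" using assms by auto
    show "s ^ n \<noteq> 1" if "n > 0" for n
    proof
      assume "s ^ n = 1"
      then have "q ^ n = 1" using assms(3) by (metis power_mult power_commutes mult.commute power_one)
      then show False using assms(2) that by blast
    qed
  qed
  have data: "nonclassical_data s \<kappa> e1 e2 e3 j j'"
    if "\<kappa> \<in> {\<i>, 1}" "(e1, e2, e3, j, j') \<in> ordered_params" for \<kappa> e1 e2 e3 j j'
    using root that by (intro nonclassical_data.intro nonclassical_data_axioms.intro)
      (auto simp: ordered_params_def)
  have rep: "is_representation q (nonclassical 1 s p)" if "p \<in> ordered_params" for p
  proof (cases p)
    case (fields e1 e2 e3 j j')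
    then show ?thesis
      using nonclassical_data.representation[OF data[of 1 e1 e2 e3 j j']] that assms(3) by simp
  qed
  have irr: "irreducible_action (nonclassical \<kappa> s p)" if "\<kappa> \<in> {\<i>, 1}" "p \<in> ordered_params" for \<kappa> p
  proof (cases p)
    case (fields e1 e2 e3 j j')
    then show ?thesis using nonclassical_data.irreducible[OF data[of \<kappa> e1 e2 e3 j j']] that by simp
  qed
  have eq: "p = p'"
    if k: "\<kappa> \<in> {\<i>, 1}" and p: "p \<in> ordered_params" "p' \<in> ordered_params"
      and equiv: "equivalent_actions (nonclassical \<kappa> s p) (nonclassical \<kappa> s p')" for \<kappa> p p'
  proof -
    obtain e1 e2 e3 j j' where P: "p = (e1, e2, e3, j, j')" by (cases p)
    obtain f1 f2 f3 i i' where P': "p' = (f1, f2, f3, i, i')" by (cases p')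
    have ord: "j' \<le> j" "i' \<le> i" using p P P' by (auto simp: ordered_params_def)
    interpret R: nonclassical_data s \<kappa> e1 e2 e3 j j' using data k p P by blast
    interpret R': nonclassical_data s \<kappa> f1 f2 f3 i i' using data k p P' by blast
    have equiv1: "equivalent_actions R.rep R'.rep" using equiv P P' by simp
    \<comment> \<open>The comparison of spins is one-sided; the inverse intertwiner supplies the
      opposite inequalities.\<close>
    then have equiv2: "equivalent_actions R'.rep R.rep"
      using R.rep_closed by (intro equivalent_actions_sym[OF _ R.subspace_Sp]) auto
    have 1: "e1 = f1" "e2 = f2" "j \<le> i" "j' \<le> i'"
      using R.equivalent_imp_signs_and_bounds[OF R'.nonclassical_data_axioms equiv1 ord] by auto
    have "i \<le> j" "i' \<le> j'"
      using R'.equivalent_imp_signs_and_bounds[OF R.nonclassical_data_axioms equiv2 ord(2,1)] by auto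
    with 1 have 2: "f1 = e1" "f2 = e2" "i = j" "i' = j'" by auto
    have "e3 = f3"
      using R.equivalent_imp_third_sign R'.nonclassical_data_axioms equiv1 unfolding 2 by blast
    then show ?thesis using P P' 2 by simp
  qed
  show ?thesis using rep irr eq by blast
qed

end
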